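(* Let $B$ be a unital $C^*$-algebra and let $M\subset B$ be a unital, separable, norm-closed subspace. Let $\mathcal{P}_0$ be the set of pure states $\omega$ on $B$ for which there is a smooth point $x$ of the unit sphere of $(M,\operatorname{nr}(\cdot))$ satisfying $|\omega(x)|=1$. Let $\mathcal{P}(M)$ denote the set of pure states $\omega$ on $B$ such that $E_\omega$ contains a non-empty $M$-peak set. Then the sets $\{\omega|_M:\omega\in\mathcal{P}_0\}$ and $\{\omega|_M:\omega\in\mathcal{P}(M)\}$ are both weak-$*$ dense in the pure states on $M$.
   Context: A unital subspace of $B$ is a complex linear subspace containing the unit $I$. A state on a unital subspace $M$ is a unital contractive linear functional on $M$; $\mathcal{S}(M)$ is the set of states on $M$ with the weak-$*$ topology; pure states are its extreme points. For a state $\omega$ on $B$, $E_\omega=\{\psi\in\mathcal{S}(B):\psi|_M=\omega|_M\}$. The numerical radius of $b\in B$ is $\operatorname{nr}(b)=\sup_{\phi\in\mathcal{S}(B)}|\phi(b)|$; it is a norm on $M$ equivalent to the $C^*$-norm. A point $x$ of the unit sphere of a normed space $Y$ is smooth if there is a unique bounded linear functional $\lambda:Y\to\mathbb{C}$ with $\|\lambda\|=1=\lambda(x)$. A subset $E\subset\mathcal{S}(B)$ is an $M$-peak set if there is $x\in M$ such that $\phi(x)=1$ for every $\phi\in E$, while $|\psi(x)|<1$ for every $\psi\in\mathcal{S}(B)\setminus E$. *)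

theory Defs
  imports "HOL-Analysis.Analysis"
begin

section \<open>Unital C*-algebras\<close>

text \<open>
  The unit comes from the class \<open>monoid_mult\<close> rather than \<open>real_normed_algebra_1\<close>, so that the zero
  algebra is not excluded; for a nonzero algebra \<open>norm 1 = 1\<close> follows from the C*-identity.
\<close>

class unital_cstar_algebra = real_normed_algebra + banach + monoid_mult +
  fixes scaleC :: "complex \<Rightarrow> 'a \<Rightarrow> 'a"  (infixr \<open>*\<^sub>C\<close> 75)
    and adj :: "'a \<Rightarrow> 'a"
  assumes scaleC_add_right: "a *\<^sub>C (x + y) = a *\<^sub>C x + a *\<^sub>C y"
    and scaleC_add_left: "(a + b) *\<^sub>C x = a *\<^sub>C x + b *\<^sub>C x"
    and scaleC_scaleC: "a *\<^sub>C b *\<^sub>C x = (a * b) *\<^sub>C x"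
    and scaleR_scaleC: "r *\<^sub>R x = complex_of_real r *\<^sub>C x"
    and norm_scaleC: "norm (a *\<^sub>C x) = cmod a * norm x"
    and mult_scaleC_left: "(a *\<^sub>C x) * y = a *\<^sub>C (x * y)"
    and mult_scaleC_right: "x * (a *\<^sub>C y) = a *\<^sub>C (x * y)"
    and adj_adj: "adj (adj x) = x"
    and adj_add: "adj (x + y) = adj x + adj y"
    and adj_scaleC: "adj (a *\<^sub>C x) = cnj a *\<^sub>C adj x"
    and adj_mult: "adj (x * y) = adj y * adj x"
    and cstar_identity: "norm (adj x * x) = (norm x)\<^sup>2"

lemma scaleC_one: "1 *\<^sub>C x = (x :: 'a::unital_cstar_algebra)"
  using scaleR_scaleC[of 1 x] by simp

global_interpretation complex_vector: vector_space "scaleC :: complex \<Rightarrow> 'a \<Rightarrow> 'a::unital_cstar_algebra"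
  by unfold_locales
    (simp_all add: scaleC_add_right scaleC_add_left scaleC_scaleC scaleC_one)

definition unital_subspace :: "'a::unital_cstar_algebra set \<Rightarrow> bool" where
  "unital_subspace M \<longleftrightarrow> module.subspace scaleC M \<and> 1 \<in> M"

section \<open>Functionals, states and pure states\<close>

text \<open>
  A functional on a subspace \<open>M\<close> is a function that is \<open>undefined\<close> outside \<open>M\<close>, so that equality of
  such functions is equality on \<open>M\<close>, and \<open>restrict \<omega> M\<close> is the functional obtained from \<open>\<omega>\<close> by
  restriction. The states on the whole algebra are \<open>states UNIV\<close>.
\<close>

definition linear_functionals :: "'a::unital_cstar_algebra set \<Rightarrow> ('a \<Rightarrow> complex) set" where
  "linear_functionals M = {f \<in> extensional M.
     (\<forall>x\<in>M. \<forall>y\<in>M. f (x + y) = f x + f y) \<and> (\<forall>c. \<forall>x\<in>M. f (c *\<^sub>C x) = c * f x)}"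

definition states :: "'a::unital_cstar_algebra set \<Rightarrow> ('a \<Rightarrow> complex) set" where
  "states M = {\<phi> \<in> linear_functionals M. \<phi> 1 = 1 \<and> (\<forall>x\<in>M. cmod (\<phi> x) \<le> norm x)}"

text \<open>
  The weak-* topology is that of pointwise convergence on \<open>M\<close>; note that
  \<open>topspace (product_topology (\<lambda>_. euclidean) M) = extensional M\<close>.
\<close>

definition weak_star :: "'a::unital_cstar_algebra set \<Rightarrow> ('a \<Rightarrow> complex) topology" where
  "weak_star M = subtopology (product_topology (\<lambda>_. euclidean) M) (states M)"

text \<open>
  Extreme points of the state space, written out because \<open>extreme_point_of\<close> requires the class
  \<open>real_vector\<close>, of which the function type is not an instance.
\<close>

definition pure_states :: "'a::unital_cstar_algebra set \<Rightarrow> ('a \<Rightarrow> complex) set" where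
  "pure_states M = {\<omega> \<in> states M. \<forall>\<phi>\<in>states M. \<forall>\<psi>\<in>states M. \<forall>t::real. 0 < t \<longrightarrow> t < 1 \<longrightarrow>
     (\<forall>x\<in>M. \<omega> x = complex_of_real (1 - t) * \<phi> x + complex_of_real t * \<psi> x) \<longrightarrow> \<phi> = \<psi>}"

definition state_extensions ::
    "'a::unital_cstar_algebra set \<Rightarrow> ('a \<Rightarrow> complex) \<Rightarrow> ('a \<Rightarrow> complex) set" where
  "state_extensions M \<omega> = {\<psi> \<in> states UNIV. restrict \<psi> M = restrict \<omega> M}"

section \<open>Numerical radius and smooth points\<close>

definition numerical_radius :: "'a::unital_cstar_algebra \<Rightarrow> real" where
  "numerical_radius b = (SUP \<phi>\<in>states UNIV. cmod (\<phi> b))"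

definition bounded_functionals ::
    "('a::unital_cstar_algebra \<Rightarrow> real) \<Rightarrow> 'a set \<Rightarrow> ('a \<Rightarrow> complex) set" where
  "bounded_functionals N M = {f \<in> linear_functionals M. \<exists>K. \<forall>y\<in>M. cmod (f y) \<le> K * N y}"

definition functional_norm ::
    "('a::unital_cstar_algebra \<Rightarrow> real) \<Rightarrow> 'a set \<Rightarrow> ('a \<Rightarrow> complex) \<Rightarrow> real" where
  "functional_norm N M f = (SUP y\<in>{y\<in>M. N y \<le> 1}. cmod (f y))"

text \<open>Smooth points of the unit sphere of the space \<open>M\<close> normed by \<open>N\<close>.\<close>

definition smooth_points ::
    "('a::unital_cstar_algebra \<Rightarrow> real) \<Rightarrow> 'a set \<Rightarrow> 'a set" where
  "smooth_points N M = {x \<in> M. N x = 1 \<and>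
     (\<exists>!f. f \<in> bounded_functionals N M \<and> functional_norm N M f = 1 \<and> f x = 1)}"

section \<open>Peak sets\<close>

definition peak_set :: "'a::unital_cstar_algebra set \<Rightarrow> ('a \<Rightarrow> complex) set \<Rightarrow> bool" where
  "peak_set M E \<longleftrightarrow> E \<subseteq> states UNIV \<and>
     (\<exists>x\<in>M. (\<forall>\<phi>\<in>E. \<phi> x = 1) \<and> (\<forall>\<psi>\<in>states UNIV - E. cmod (\<psi> x) < 1))"

definition smooth_pure_states :: "'a::unital_cstar_algebra set \<Rightarrow> ('a \<Rightarrow> complex) set" where
  "smooth_pure_states M =
     {\<omega> \<in> pure_states UNIV. \<exists>x\<in>smooth_points numerical_radius M. cmod (\<omega> x) = 1}"

definition peak_pure_states :: "'a::unital_cstar_algebra set \<Rightarrow> ('a \<Rightarrow> complex) set" where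
  "peak_pure_states M =
     {\<omega> \<in> pure_states UNIV. \<exists>E. E \<noteq> {} \<and> E \<subseteq> state_extensions M \<omega> \<and> peak_set M E}"

text \<open>Density of \<open>A\<close> in the space of pure states on \<open>M\<close>; this includes \<open>A \<subseteq> pure_states M\<close>.\<close>

definition weak_star_dense_in_pure_states ::
    "'a::unital_cstar_algebra set \<Rightarrow> ('a \<Rightarrow> complex) set \<Rightarrow> bool" where
  "weak_star_dense_in_pure_states M A \<longleftrightarrow> A \<subseteq> pure_states M \<and>
     subtopology (weak_star M) (pure_states M) closure_of A = pure_states M"

end

theory Submission
  imports Defs
begin

text \<open>
  Let \<open>x\<close> be a smooth point of the unit sphere of \<open>(M, nr)\<close>. A state \<open>\<phi>\<close> on \<open>M\<close> with \<open>|\<phi> x| = 1\<close>,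
  divided by the phase \<open>\<phi> x\<close>, is a support functional at \<open>x\<close>, so smoothness makes all such rotated
  states coincide; evaluation at \<open>1\<close> recovers the phase. Hence exactly one state on \<open>M\<close> has modulus
  one at \<open>x\<close>. Being exposed in this way, it is pure, and its extensions to the whole algebra are the
  states taking the value one at a multiple of \<open>x\<close>, a peak set. This gives
  \<open>smooth_pure_states_subset_peak\<close>, and the same exposure argument shows in
  \<open>peak_pure_states_restrict\<close> that peak pure states restrict to pure states. What remains is the
  density of the restrictions of smooth pure states.

  For the density fix a pure state \<open>\<omega>\<close> on \<open>M\<close> and a weak-* neighbourhood of it. The states outside
  the neighbourhood lie in finitely many slices, that is, sets of states on which the real part of
  evaluation at some point is large. The convex hull of finitely many slices is compact and, as
  \<open>\<omega>\<close> is extreme, does not meet the states that agree with \<open>\<omega>\<close> on \<open>M\<close>; so some \<open>y \<in> M\<close>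
  separates \<open>\<omega>\<close> from the slices (\<open>pure_state_slice_separation\<close>). Adding a large multiple of the
  unit to \<open>y\<close> turns this separation of real parts into one of moduli: at \<open>z = y + c 1\<close> every state
  in a slice has modulus below \<open>|\<omega> z|\<close> by a definite amount, while \<open>|\<omega> z|\<close> is at most the
  numerical radius of \<open>z\<close>. By Mazur's theorem on generic smoothness of separable Banach spaces
  (\<open>unique_support_functional_dense\<close>), \<open>z\<close> can be moved slightly to a multiple of a smooth point.
  A state attaining the numerical radius there lies in no slice, hence in the neighbourhood; its
  restriction to \<open>M\<close> is pure and extends to a pure state on the whole algebra.

  Three classical tools support this. The Hahn-Banach theorem extends states from \<open>M\<close>. The
  Krein-Milman argument, in the form that a nonempty closed face of the state space contains a pure
  state, extends pure states from \<open>M\<close>. The Baire category theorem for the complete space \<open>M\<close> gives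
  Mazur's theorem; completeness is used for the original norm, with the numerical radius entering
  only as a 1-Lipschitz function.
\<close>

section \<open>Sublinear functionals and the Hahn-Banach theorem\<close>

definition sublinear :: "('a::real_vector \<Rightarrow> real) \<Rightarrow> bool" where
  "sublinear p \<longleftrightarrow> (\<forall>x y. p (x + y) \<le> p x + p y) \<and> (\<forall>r\<ge>0. \<forall>x. p (r *\<^sub>R x) = r * p x)"

lemma sublinear_add: "sublinear p \<Longrightarrow> p (x + y) \<le> p x + p y"
  and sublinear_scaleR: "sublinear p \<Longrightarrow> 0 \<le> r \<Longrightarrow> p (r *\<^sub>R x) = r * p x"
  by (auto simp: sublinear_def)

lemma sublinear_zero: "sublinear p \<Longrightarrow> p 0 = 0"
  using sublinear_scaleR[of p 0 0] by simp

lemma sublinear_uminus_le: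
  assumes "sublinear p"
  shows "- p (- x) \<le> p x"
  using sublinear_add[OF assms, of x "-x"] sublinear_zero[OF assms] by simp

text \<open>
  Infima of sublinear functionals are taken three times below: along a chain, along the ray spanned
  by a vector, and over a subspace. In the last two cases the members of the family are not sublinear
  themselves, and the inequalities hold after passing to another index.
\<close>

lemma sublinear_INF:
  fixes g :: "'i \<Rightarrow> 'a::real_vector \<Rightarrow> real"
  assumes ne: "I \<noteq> {}"
    and bdd: "\<And>x. bdd_below ((\<lambda>i. g i x) ` I)"
    and add: "\<And>i j x y. i \<in> I \<Longrightarrow> j \<in> I \<Longrightarrow> \<exists>k\<in>I. g k (x + y) \<le> g i x + g j y"
    and scale: "\<And>i r x. i \<in> I \<Longrightarrow> 0 < r \<Longrightarrow> \<exists>k\<in>I. g k (r *\<^sub>R x) \<le> r * g i x"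
  shows "sublinear (\<lambda>x. INF i\<in>I. g i x)"
proof -
  let ?q = "\<lambda>x. INF i\<in>I. g i x"
  have low: "?q x \<le> g i x" if "i \<in> I" for i x
    using cINF_lower[OF bdd that] .
  have add': "?q (x + y) \<le> ?q x + ?q y" for x y
  proof -
    have "?q (x + y) \<le> g i x + g j y" if "i \<in> I" "j \<in> I" for i j
      using add[OF that, of x y] low by (meson order_trans)
    then have "?q (x + y) - g i x \<le> ?q y" if "i \<in> I" for i
      using that by (intro cINF_greatest[OF ne]) (simp add: diff_le_eq add.commute[of _ "g i x"])
    then have "?q (x + y) - ?q y \<le> ?q x"
      by (intro cINF_greatest[OF ne]) (simp add: algebra_simps)
    then show ?thesis by simp
  qed
  have le: "?q (r *\<^sub>R x) \<le> r * ?q x" if "0 < r" for r x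
  proof -
    have "?q (r *\<^sub>R x) \<le> r * g i x" if "i \<in> I" for i
      using scale[OF that \<open>0 < r\<close>, of x] low by (meson order_trans)
    then have "?q (r *\<^sub>R x) / r \<le> ?q x"
      using \<open>0 < r\<close> by (intro cINF_greatest[OF ne]) (simp add: field_simps)
    then show ?thesis using \<open>0 < r\<close> by (simp add: field_simps)
  qed
  have zero: "?q 0 = 0"
    using le[of 2 0] le[of "1/2" 0] by simp
  have "?q (r *\<^sub>R x) = r * ?q x" if "0 \<le> r" for r x
  proof (cases "r = 0")
    case False
    then have r: "0 < r" using that by simp
    have "?q x \<le> inverse r * ?q (r *\<^sub>R x)"
      using le[of "inverse r" "r *\<^sub>R x"] r by simp
    then have "r * ?q x \<le> ?q (r *\<^sub>R x)"
      using r by (simp add: field_simps)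
    with le[OF r, of x] show ?thesis by simp
  qed (use zero in simp)
  with add' show ?thesis by (simp add: sublinear_def)
qed

text \<open>
  For a vector \<open>a\<close>, the functional \<open>INF t\<ge>0. p (x + t a) - t p a\<close> is sublinear and below \<open>p\<close>, hence
  equal to \<open>p\<close> by minimality. Comparing with the term \<open>t = 1\<close> gives \<open>p x + p a \<le> p (x + a)\<close>, the
  inequality that is opposite to subadditivity.
\<close>

lemma minimal_sublinear_imp_linear:
  assumes p: "sublinear p"
    and minimal: "\<And>q. sublinear q \<Longrightarrow> (\<And>x. q x \<le> p x) \<Longrightarrow> q = p"
  shows "linear p"
proof -
  have superadd: "p x + p a \<le> p (x + a)" for x a
  proof -
    define g where "g = (\<lambda>t x. p (x + t *\<^sub>R a) - t * p a)"
    have bdd: "bdd_below ((\<lambda>t. g t x) ` {0..})" for x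
    proof (rule bdd_belowI)
      fix v assume "v \<in> (\<lambda>t. g t x) ` {0..}"
      then obtain t where t: "0 \<le> t" "v = g t x" by auto
      have "t * p a \<le> p (x + t *\<^sub>R a) + p (- x)"
        using sublinear_add[OF p, of "x + t *\<^sub>R a" "- x"] sublinear_scaleR[OF p t(1), of a] by simp
      then show "- p (- x) \<le> v" using t by (simp add: g_def)
    qed
    have sub: "sublinear (\<lambda>x. INF t\<in>{0..}. g t x)"
    proof (rule sublinear_INF[OF _ bdd])
      fix s t :: real and x y assume st: "s \<in> {0..}" "t \<in> {0..}"
      have "g (s + t) (x + y) \<le> g s x + g t y"
        using sublinear_add[OF p, of "x + s *\<^sub>R a" "y + t *\<^sub>R a"]
        by (simp add: g_def algebra_simps)
      then show "\<exists>k\<in>{0..}. g k (x + y) \<le> g s x + g t y"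
        using st by (intro bexI[of _ "s + t"]) auto
    next
      fix t r :: real and x assume tr: "t \<in> {0..}" "0 < r"
      have "g (r * t) (r *\<^sub>R x) \<le> r * g t x"
        using sublinear_scaleR[OF p, of r "x + t *\<^sub>R a"] tr by (simp add: g_def algebra_simps)
      then show "\<exists>k\<in>{0..}. g k (r *\<^sub>R x) \<le> r * g t x"
        using tr by (intro bexI[of _ "r * t"]) auto
    qed auto
    have "(INF t\<in>{0..}. g t x) \<le> p x" for x
      using cINF_lower[OF bdd, of 0 x] by (simp add: g_def)
    then have "(\<lambda>x. INF t\<in>{0..}. g t x) = p"
      using minimal[OF sub] by simp
    then have "p x \<le> g 1 x"
      using cINF_lower[OF bdd, of 1 x] by (metis atLeast_iff zero_le_one)
    then show ?thesis by (simp add: g_def)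
  qed
  have add: "p (x + y) = p x + p y" for x y
    using superadd sublinear_add[OF p] by (meson antisym)
  have neg: "p (- x) = - p x" for x
    using add[of x "- x"] sublinear_zero[OF p] by simp
  show ?thesis
  proof (rule linearI[OF add])
    fix r x
    show "p (r *\<^sub>R x) = r *\<^sub>R p x"
    proof (cases "0 \<le> r")
      case False
      then have "p (r *\<^sub>R x) = - ((- r) * p x)"
        using sublinear_scaleR[OF p, of "- r" x] neg[of "r *\<^sub>R x"] by simp
      then show ?thesis by simp
    qed (simp add: sublinear_scaleR[OF p])
  qed
qed

text \<open>
  Zorn's lemma provides a minimal sublinear functional below \<open>q\<close>: chains have infima because every
  sublinear \<open>p\<close> below \<open>q\<close> satisfies \<open>- q (- x) \<le> - p (- x) \<le> p x\<close>.
\<close>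

lemma linear_below_sublinear:
  assumes q: "sublinear q"
  shows "\<exists>F. linear F \<and> (\<forall>x. F x \<le> q x)"
proof -
  let ?A = "{p. sublinear p \<and> (\<forall>x. p x \<le> q x)}"
  let ?P = "\<lambda>p p'::'a \<Rightarrow> real. \<forall>x. p' x \<le> p x"
  have "\<exists>m\<in>?A. \<forall>a\<in>?A. ?P m a \<longrightarrow> a = m"
  proof (rule predicate_Zorn)
    show "partial_order_on ?A (relation_of ?P ?A)"
      by (rule partial_order_on_relation_ofI) (auto intro: order_trans intro!: ext antisym)
  next
    fix C assume C: "C \<in> Chains (relation_of ?P ?A)"
    then have CA: "C \<subseteq> ?A"
      by (auto simp: Chains_def relation_of_def)
    show "\<exists>u\<in>?A. \<forall>a\<in>C. ?P a u"
    proof (cases "C = {}")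
      case False
      have bdd: "bdd_below ((\<lambda>p. p x) ` C)" for x
      proof (rule bdd_belowI)
        fix v assume "v \<in> (\<lambda>p. p x) ` C"
        then obtain p where p: "p \<in> C" "v = p x" by auto
        with CA have "- p (- x) \<le> v" "p (- x) \<le> q (- x)"
          using sublinear_uminus_le by auto
        then show "- q (- x) \<le> v" by simp
      qed
      have "sublinear (\<lambda>x. INF p\<in>C. p x)"
      proof (rule sublinear_INF[OF False bdd])
        fix i j x y assume ij: "i \<in> C" "j \<in> C"
        then have sub: "sublinear i" "sublinear j" using CA by auto
        from C ij consider "\<forall>x. i x \<le> j x" | "\<forall>x. j x \<le> i x"
          by (auto simp: Chains_def relation_of_def)
        then show "\<exists>k\<in>C. k (x + y) \<le> i x + j y"
        proof cases
          case 1
          then have "i (x + y) \<le> i x + j y"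
            using sublinear_add[OF sub(1), of x y] by (smt (verit))
          then show ?thesis using ij by blast
        next
          case 2
          then have "j (x + y) \<le> i x + j y"
            using sublinear_add[OF sub(2), of x y] by (smt (verit))
          then show ?thesis using ij by blast
        qed
      next
        fix i r x assume "i \<in> C" "0 < (r::real)"
        then show "\<exists>k\<in>C. k (r *\<^sub>R x) \<le> r * i x"
          using CA sublinear_scaleR[of i r x] by (intro bexI[of _ i]) auto
      qed
      moreover have low: "(INF p\<in>C. p x) \<le> p x" if "p \<in> C" for p x
        using cINF_lower[OF bdd that] .
      moreover have "(INF p\<in>C. p x) \<le> q x" for x
      proof -
        obtain p where "p \<in> C" using False by blast
        then have "p x \<le> q x" using CA by blast
        with low[OF \<open>p \<in> C\<close>, of x] show ?thesis by linarith
      qed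
      ultimately show ?thesis
        by (intro bexI[of _ "\<lambda>x. INF p\<in>C. p x"]) auto
    qed (use q in auto)
  qed
  then obtain m where m: "m \<in> ?A" "\<And>a. a \<in> ?A \<Longrightarrow> (\<And>x. a x \<le> m x) \<Longrightarrow> a = m"
    by blast
  have "linear m"
  proof (rule minimal_sublinear_imp_linear)
    fix a assume "sublinear a" "\<And>x. a x \<le> m x"
    moreover have "a x \<le> q x" for x
      using m(1) calculation(2)[of x] by (auto intro: order_trans)
    ultimately show "a = m"
      using m(2) by blast
  qed (use m in auto)
  then show ?thesis using m(1) by blast
qed

text \<open>
  The sublinear functional \<open>INF m\<in>M. p (x - m) + f m\<close> is below \<open>p\<close> everywhere and below \<open>f\<close> on \<open>M\<close>.
  A linear functional below it is therefore below \<open>f\<close> on the subspace \<open>M\<close>, and equal to \<open>f\<close> there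
  because it is so at both \<open>x\<close> and \<open>- x\<close>.
\<close>

theorem Hahn_Banach_sublinear:
  fixes f :: "'a::real_vector \<Rightarrow> real"
  assumes p: "sublinear p" and M: "subspace M"
    and add: "\<And>x y. x \<in> M \<Longrightarrow> y \<in> M \<Longrightarrow> f (x + y) = f x + f y"
    and scale: "\<And>r x. x \<in> M \<Longrightarrow> f (r *\<^sub>R x) = r * f x"
    and le: "\<And>x. x \<in> M \<Longrightarrow> f x \<le> p x"
  shows "\<exists>F. linear F \<and> (\<forall>x\<in>M. F x = f x) \<and> (\<forall>x. F x \<le> p x)"
proof -
  define g where "g = (\<lambda>m x. p (x - m) + f m)"
  have neg: "f (- m) = - f m" if "m \<in> M" for m
    using scale[OF that, of "-1"] by simp
  have zero: "0 \<in> M" "f 0 = 0"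
    using subspace_0[OF M] scale[of 0 0] by auto
  have bdd: "bdd_below ((\<lambda>m. g m x) ` M)" for x
  proof (rule bdd_belowI)
    fix v assume "v \<in> (\<lambda>m. g m x) ` M"
    then obtain m where m: "m \<in> M" "v = g m x" by auto
    have "- f m \<le> p (x - m) + p (- x)"
      using le[OF subspace_neg[OF M m(1)]] neg[OF m(1)] sublinear_add[OF p, of "x - m" "- x"]
      by simp
    then show "- p (- x) \<le> v" using m by (simp add: g_def)
  qed
  have sub: "sublinear (\<lambda>x. INF m\<in>M. g m x)"
  proof (rule sublinear_INF[OF _ bdd])
    fix m n x y assume mn: "m \<in> M" "n \<in> M"
    have "g (m + n) (x + y) \<le> g m x + g n y"
      using sublinear_add[OF p, of "x - m" "y - n"] add[OF mn]
      by (simp add: g_def algebra_simps)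
    then show "\<exists>k\<in>M. g k (x + y) \<le> g m x + g n y"
      using subspace_add[OF M mn] by blast
  next
    fix m r x assume m: "m \<in> M" and r: "0 < (r::real)"
    have "g (r *\<^sub>R m) (r *\<^sub>R x) \<le> r * g m x"
      using sublinear_scaleR[OF p, of r "x - m"] scale[OF m, of r] r
      by (simp add: g_def algebra_simps)
    then show "\<exists>k\<in>M. g k (r *\<^sub>R x) \<le> r * g m x"
      using subspace_scale[OF M m] by blast
  qed (use zero in auto)
  obtain F where F: "linear F" "\<And>x. F x \<le> (INF m\<in>M. g m x)"
    using linear_below_sublinear[OF sub] by blast
  have Fg: "F x \<le> g m x" if "m \<in> M" for m x
    using F(2)[of x] cINF_lower[OF bdd that] by (rule order_trans)
  have leF: "F x \<le> f x" if "x \<in> M" for x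
    using Fg[OF that, of x] sublinear_zero[OF p] by (simp add: g_def)
  have "F x = f x" if "x \<in> M" for x
    using leF[OF that] leF[OF subspace_neg[OF M that]] neg[OF that] linear_neg[OF F(1), of x]
    by simp
  moreover have "F x \<le> p x" for x
    using Fg[OF zero(1), of x] zero(2) by (simp add: g_def)
  ultimately show ?thesis using F(1) by blast
qed

section \<open>Extension of states\<close>

lemma scaleC_closed:
  "unital_subspace M \<Longrightarrow> x \<in> M \<Longrightarrow> c *\<^sub>C x \<in> M"
  and add_closed: "unital_subspace M \<Longrightarrow> x \<in> M \<Longrightarrow> y \<in> M \<Longrightarrow> x + y \<in> M"
  and one_closed: "unital_subspace M \<Longrightarrow> 1 \<in> M"
  and real_subspace: "unital_subspace M \<Longrightarrow> subspace M"
  by (auto simp: unital_subspace_def complex_vector.subspace_def subspace_def scaleR_scaleC)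

lemma unital_subspace_UNIV: "unital_subspace UNIV"
  by (simp add: unital_subspace_def complex_vector.subspace_def)

lemma functional_add: "f \<in> linear_functionals M \<Longrightarrow> x \<in> M \<Longrightarrow> y \<in> M \<Longrightarrow> f (x + y) = f x + f y"
  and functional_scaleC: "f \<in> linear_functionals M \<Longrightarrow> x \<in> M \<Longrightarrow> f (c *\<^sub>C x) = c * f x"
  and functional_scaleR: "f \<in> linear_functionals M \<Longrightarrow> x \<in> M \<Longrightarrow> f (r *\<^sub>R x) = complex_of_real r * f x"
  by (auto simp: linear_functionals_def scaleR_scaleC)

lemma functional_eqI:
  "f \<in> linear_functionals M \<Longrightarrow> g \<in> linear_functionals M \<Longrightarrow> (\<And>x. x \<in> M \<Longrightarrow> f x = g x) \<Longrightarrow> f = g"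
  by (auto simp: linear_functionals_def intro: extensionalityI)

lemma states_functional: "\<phi> \<in> states M \<Longrightarrow> \<phi> \<in> linear_functionals M"
  and states_one: "\<phi> \<in> states M \<Longrightarrow> \<phi> 1 = 1"
  and states_bound: "\<phi> \<in> states M \<Longrightarrow> x \<in> M \<Longrightarrow> cmod (\<phi> x) \<le> norm x"
  by (auto simp: states_def)

lemma restrict_state:
  assumes "unital_subspace M" "\<phi> \<in> states UNIV"
  shows "restrict \<phi> M \<in> states M"
  using assms
  by (auto simp: states_def linear_functionals_def scaleC_closed add_closed one_closed)

text \<open>
  A complex functional is determined by its real part \<open>F\<close> through \<open>F x - \<i> F (\<i> x)\<close>. The real part
  of a state is dominated by the norm, so it extends with the same bound, and rotating an argument
  until the value is nonnegative turns the bound on the real part into one on the modulus.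
\<close>

theorem state_extension:
  fixes M :: "'b::unital_cstar_algebra set"
  assumes M: "unital_subspace M" and \<omega>: "\<omega> \<in> states M"
  shows "\<exists>\<psi>\<in>states UNIV. restrict \<psi> M = \<omega>"
proof -
  note lin = states_functional[OF \<omega>]
  have "sublinear (norm :: 'b \<Rightarrow> real)"
    by (simp add: sublinear_def norm_triangle_ineq)
  then have "\<exists>F. linear F \<and> (\<forall>x\<in>M. F x = Re (\<omega> x)) \<and> (\<forall>x. F x \<le> norm x)"
    using M lin states_bound[OF \<omega>]
    by (intro Hahn_Banach_sublinear)
       (auto simp: real_subspace functional_add functional_scaleR intro: order_trans[OF complex_Re_le_cmod])
  then obtain F where F: "linear F" "\<And>x. x \<in> M \<Longrightarrow> F x = Re (\<omega> x)" "\<And>x. F x \<le> norm x"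
    by blast
  define \<psi> where "\<psi> x = Complex (F x) (- F (\<i> *\<^sub>C x))" for x
  have Fadd: "F (x + y) = F x + F y" for x y
    by (rule linear_add[OF F(1)])
  have Fscale: "F (r *\<^sub>R x) = r * F x" for r x
    using linear_scale[OF F(1)] by simp
  have Fc: "F (c *\<^sub>C x) = Re c * F x + Im c * F (\<i> *\<^sub>C x)" for c x
  proof -
    have "c *\<^sub>C x = Re c *\<^sub>R x + Im c *\<^sub>R (\<i> *\<^sub>C x)"
      by (simp add: scaleR_scaleC scaleC_scaleC flip: scaleC_add_left)
        (simp add: complex_eq mult.commute)
    then show ?thesis by (simp add: Fadd Fscale)
  qed
  have scale: "\<psi> (c *\<^sub>C x) = c * \<psi> x" for c x
    using Fc[of c x] Fc[of "\<i> * c" x]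
    by (simp add: \<psi>_def scaleC_scaleC complex_eq_iff algebra_simps)
  have add: "\<psi> (x + y) = \<psi> x + \<psi> y" for x y
    by (simp add: \<psi>_def Fadd scaleC_add_right complex_eq_iff)
  have eq: "\<psi> x = \<omega> x" if "x \<in> M" for x
    using F(2)[OF that] F(2)[OF scaleC_closed[OF M that, of \<i>]] functional_scaleC[OF lin that, of \<i>]
    by (simp add: \<psi>_def complex_eq_iff)
  have bound: "cmod (\<psi> x) \<le> norm x" for x
  proof (cases "\<psi> x = 0")
    case False
    define c where "c = cnj (sgn (\<psi> x))"
    have "cmod c = 1" using False by (simp add: c_def norm_sgn)
    have "\<psi> (c *\<^sub>C x) = cmod (\<psi> x)"
      using False unfolding scale c_def sgn_eq
      by (simp add: field_simps complex_norm_square[symmetric] power2_eq_square)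
    then have "cmod (\<psi> x) = F (c *\<^sub>C x)"
      by (simp add: \<psi>_def complex_eq_iff)
    also have "\<dots> \<le> norm x"
      using F(3)[of "c *\<^sub>C x"] \<open>cmod c = 1\<close> by (simp add: norm_scaleC)
    finally show ?thesis .
  qed simp
  have "\<psi> \<in> states UNIV"
    using add scale bound eq[OF one_closed[OF M]] states_one[OF \<omega>]
    by (simp add: states_def linear_functionals_def)
  moreover have "restrict \<psi> M = \<omega>"
    using eq lin by (auto simp: linear_functionals_def extensional_def restrict_def)
  ultimately show ?thesis by blast
qed

section \<open>Compactness of the state space and pure extensions\<close>

lemma continuous_on_evaluation:
  "continuous_on S (\<lambda>f. f i :: 'c::topological_space)"
  by (rule continuous_on_subset[OF continuous_on_product_coordinates subset_UNIV])

lemma compact_of_pointwise_bound: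
  fixes S :: "('i \<Rightarrow> 'c::{real_normed_vector, heine_borel}) set"
  assumes "closed S" and bound: "\<And>f i. f \<in> S \<Longrightarrow> norm (f i) \<le> B i"
  shows "compact S"
proof -
  let ?P = "PiE UNIV (\<lambda>i. cball 0 (B i)) :: ('i \<Rightarrow> 'c) set"
  have "compactin (product_topology (\<lambda>_. euclidean) UNIV) ?P"
    by (simp add: compactin_PiE)
  then have "compact ?P"
    by (simp add: euclidean_product_topology)
  then have "compact (?P \<inter> S)"
    by (rule compact_Int_closed[OF _ assms(1)])
  moreover have "?P \<inter> S = S"
    using bound by (auto simp: PiE_iff)
  ultimately show ?thesis by (rule back_subst)
qed

lemma closed_states: "closed (states UNIV :: ('b::unital_cstar_algebra \<Rightarrow> complex) set)"
proof -
  have add: "closed {\<phi>::'b \<Rightarrow> complex. \<forall>x y. \<phi> (x + y) = \<phi> x + \<phi> y}"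
    by (intro closed_Collect_all closed_Collect_eq continuous_on_add continuous_on_evaluation)
  have scale: "closed {\<phi>::'b \<Rightarrow> complex. \<forall>c x. \<phi> (c *\<^sub>C x) = c * \<phi> x}"
    by (intro closed_Collect_all closed_Collect_eq continuous_on_mult continuous_on_const
        continuous_on_evaluation)
  have one: "closed {\<phi>::'b \<Rightarrow> complex. \<phi> 1 = 1}"
    by (intro closed_Collect_eq continuous_on_const continuous_on_evaluation)
  have bound: "closed {\<phi>::'b \<Rightarrow> complex. \<forall>x. cmod (\<phi> x) \<le> norm x}"
    by (intro closed_Collect_all closed_Collect_le continuous_on_norm continuous_on_const
        continuous_on_evaluation)
  have "states UNIV = {\<phi>::'b \<Rightarrow> complex. \<forall>x y. \<phi> (x + y) = \<phi> x + \<phi> y} \<inter>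
      {\<phi>. \<forall>c x. \<phi> (c *\<^sub>C x) = c * \<phi> x} \<inter> {\<phi>. \<phi> 1 = 1} \<inter> {\<phi>. \<forall>x. cmod (\<phi> x) \<le> norm x}"
    by (auto simp: states_def linear_functionals_def)
  then show ?thesis
    by (rule ssubst) (rule closed_Int[OF closed_Int[OF closed_Int[OF add scale] one] bound])
qed

lemma compact_states: "compact (states UNIV :: ('b::unital_cstar_algebra \<Rightarrow> complex) set)"
proof (rule compact_of_pointwise_bound[where B = norm])
  show "cmod (\<phi> x) \<le> norm x" if "\<phi> \<in> states UNIV" for \<phi> and x :: 'b
    by (rule states_bound[OF that UNIV_I])
qed (rule closed_states)

lemma convex_combination_eq_max:
  fixes a b :: real
  assumes "0 < t" "t < 1" "a \<le> m" "b \<le> m" "m \<le> (1 - t) * a + t * b"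
  shows "a = m" "b = m"
proof -
  have "(1 - t) * (m - a) + t * (m - b) \<le> 0"
    using assms(5) by (simp add: algebra_simps)
  moreover have "0 \<le> (1 - t) * (m - a)" "0 \<le> t * (m - b)"
    using assms by auto
  ultimately have "(1 - t) * (m - a) = 0" "t * (m - b) = 0"
    by linarith+
  then show "a = m" "b = m" using assms(1,2) by auto
qed

text \<open>
  The product topology on functions on the whole algebra is the weak-* topology there, so the
  following can use \<^const>\<open>closed\<close> and \<^const>\<open>compact\<close> on the function type.
\<close>

definition state_face :: "('b::unital_cstar_algebra \<Rightarrow> complex) set \<Rightarrow> bool" where
  "state_face F \<longleftrightarrow> F \<subseteq> states UNIV \<and> (\<forall>\<phi>\<in>states UNIV. \<forall>\<psi>\<in>states UNIV. \<forall>t::real. 0 < t \<longrightarrow> t < 1 \<longrightarrow>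
     (\<lambda>x. complex_of_real (1 - t) * \<phi> x + complex_of_real t * \<psi> x) \<in> F \<longrightarrow> \<phi> \<in> F \<and> \<psi> \<in> F)"

lemma state_faceD:
  assumes "state_face F" "\<phi> \<in> states UNIV" "\<psi> \<in> states UNIV" "0 < t" "t < 1"
    "(\<lambda>x. complex_of_real (1 - t) * \<phi> x + complex_of_real t * \<psi> x) \<in> F"
  shows "\<phi> \<in> F" "\<psi> \<in> F"
  using assms unfolding state_face_def by blast+

lemma state_face_maximizers:
  assumes F: "state_face F" and max: "\<And>\<phi>. \<phi> \<in> F \<Longrightarrow> Re (\<phi> b) \<le> m"
  shows "state_face {\<phi> \<in> F. Re (\<phi> b) = m}"
  unfolding state_face_def
proof (intro conjI ballI allI impI)
  fix \<phi> \<psi> :: "'a \<Rightarrow> complex" and t :: real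
  assume S: "\<phi> \<in> states UNIV" "\<psi> \<in> states UNIV" and t: "0 < t" "t < 1"
    and mem: "(\<lambda>x. complex_of_real (1 - t) * \<phi> x + complex_of_real t * \<psi> x) \<in> {\<phi> \<in> F. Re (\<phi> b) = m}"
  have "\<phi> \<in> F" "\<psi> \<in> F"
    using state_faceD[OF F S t] mem by blast+
  moreover from this have "Re (\<phi> b) = m" "Re (\<psi> b) = m"
    using convex_combination_eq_max[OF t max max] mem by auto
  ultimately show "\<phi> \<in> {\<phi> \<in> F. Re (\<phi> b) = m}" "\<psi> \<in> {\<phi> \<in> F. Re (\<phi> b) = m}" by auto
qed (use F in \<open>auto simp: state_face_def\<close>)

lemma Re_functional_eqI:
  assumes M: "unital_subspace M" and f: "f \<in> linear_functionals M" and g: "g \<in> linear_functionals M"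
    and eq: "\<And>x. x \<in> M \<Longrightarrow> Re (f x) = Re (g x)"
  shows "f = g"
proof (rule functional_eqI[OF f g])
  fix x assume x: "x \<in> M"
  show "f x = g x"
    using eq[OF x] eq[OF scaleC_closed[OF M x, of \<i>]] functional_scaleC[OF f x, of \<i>]
      functional_scaleC[OF g x, of \<i>]
    by (simp add: complex_eq_iff)
qed

text \<open>
  Zorn's lemma gives a minimal nonempty closed face. On it every evaluation has constant real part,
  since the maximizers of the real part form a smaller closed face; so the minimal face is a single
  state, and that state is extreme.
\<close>

theorem state_face_contains_pure_state:
  fixes F :: "('b::unital_cstar_algebra \<Rightarrow> complex) set"
  assumes "state_face F" "closed F" "F \<noteq> {}"
  shows "\<exists>\<omega>\<in>F. \<omega> \<in> pure_states UNIV"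
proof -
  let ?A = "{G. G \<subseteq> F \<and> closed G \<and> G \<noteq> {} \<and> state_face G}"
  let ?P = "\<lambda>G H. H \<subseteq> G"
  have "\<exists>m\<in>?A. \<forall>a\<in>?A. ?P m a \<longrightarrow> a = m"
  proof (rule predicate_Zorn)
    show "partial_order_on ?A (relation_of ?P ?A)"
      by (rule partial_order_on_relation_ofI) auto
  next
    fix C assume C: "C \<in> Chains (relation_of ?P ?A)"
    then have CA: "C \<subseteq> ?A"
      by (auto simp: Chains_def relation_of_def)
    show "\<exists>u\<in>?A. \<forall>a\<in>C. ?P a u"
    proof (cases "C = {}")
      case False
      have fin: "\<exists>G\<in>C. G \<subseteq> \<Inter>D" if "finite D" "D \<subseteq> C" for D
        using that
      proof (induction D)
        case (insert G D)
        then obtain H where H: "H \<in> C" "H \<subseteq> \<Inter>D" by blast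
        moreover have "G \<subseteq> H \<or> H \<subseteq> G"
          using C insert.prems H by (auto simp: Chains_def relation_of_def)
        ultimately show ?case using insert.prems by auto
      qed (use False in auto)
      have "states UNIV \<inter> \<Inter>C \<noteq> {}"
      proof (rule compact_imp_fip[OF compact_states])
        fix D assume "finite D" "D \<subseteq> C"
        with fin obtain G where "G \<in> C" "G \<subseteq> \<Inter>D" by blast
        with CA show "states UNIV \<inter> \<Inter>D \<noteq> {}"
          unfolding state_face_def by blast
      qed (use CA in auto)
      then have "\<Inter>C \<noteq> {}" by blast
      moreover have "state_face (\<Inter>C)"
        using False CA unfolding state_face_def by blast
      ultimately show ?thesis
        using False CA by (intro bexI[of _ "\<Inter>C"]) auto
    qed (use assms in auto)
  qed
  then obtain G where G: "closed G" "G \<noteq> {}" "state_face G" "G \<subseteq> F"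
    and minimal: "\<And>H. H \<subseteq> G \<Longrightarrow> closed H \<Longrightarrow> H \<noteq> {} \<Longrightarrow> state_face H \<Longrightarrow> H = G"
    by (smt (verit) mem_Collect_eq order_trans)
  have GS: "G \<subseteq> states UNIV" using G(3) by (simp add: state_face_def)
  have "compact G"
    using compact_Int_closed[OF compact_states G(1)] GS by (simp add: inf.absorb2)
  have Re_eq: "Re (\<phi> b) = Re (\<psi> b)" if "\<phi> \<in> G" "\<psi> \<in> G" for \<phi> \<psi> b
  proof -
    obtain \<theta> where \<theta>: "\<theta> \<in> G" "\<And>\<phi>. \<phi> \<in> G \<Longrightarrow> Re (\<phi> b) \<le> Re (\<theta> b)"
      using continuous_attains_sup[OF \<open>compact G\<close> G(2), of "\<lambda>\<phi>. Re (\<phi> b)"]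
        continuous_on_Re[OF continuous_on_evaluation[of G b]]
      by blast
    have "{\<phi> \<in> G. Re (\<phi> b) = Re (\<theta> b)} = G"
    proof (rule minimal)
      have "closed (G \<inter> {\<phi>. Re (\<phi> b) = Re (\<theta> b)})"
        by (intro closed_Int G(1) closed_Collect_eq continuous_on_Re continuous_on_const
            continuous_on_evaluation)
      then show "closed {\<phi> \<in> G. Re (\<phi> b) = Re (\<theta> b)}"
        by (simp add: Int_def)
    qed (use \<theta> state_face_maximizers[OF G(3) \<theta>(2)] in auto)
    then have "G \<subseteq> {\<phi> \<in> G. Re (\<phi> b) = Re (\<theta> b)}" by (rule equalityD2)
    from subsetD[OF this that(1)] subsetD[OF this that(2)] show ?thesis by simp
  qed
  obtain \<omega> where \<omega>: "\<omega> \<in> G" using G(2) by blast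
  have "\<omega> \<in> pure_states UNIV"
    unfolding pure_states_def
  proof (intro CollectI conjI ballI allI impI)
    show "\<omega> \<in> states UNIV" using \<omega> GS by blast
    fix \<phi> \<psi> :: "'b \<Rightarrow> complex" and t :: real
    assume S: "\<phi> \<in> states UNIV" "\<psi> \<in> states UNIV" and t: "0 < t" "t < 1"
      and eq: "\<forall>x\<in>UNIV. \<omega> x = complex_of_real (1 - t) * \<phi> x + complex_of_real t * \<psi> x"
    then have "\<omega> = (\<lambda>x. complex_of_real (1 - t) * \<phi> x + complex_of_real t * \<psi> x)"
      by auto
    with \<omega> have "\<phi> \<in> G" "\<psi> \<in> G"
      using state_faceD[OF G(3) S t] by auto
    then show "\<phi> = \<psi>"
      using Re_functional_eqI[OF unital_subspace_UNIV states_functional[OF S(1)] states_functional[OF S(2)]]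
        Re_eq by blast
  qed
  then show ?thesis using \<omega> G(4) by blast
qed

text \<open>
  All extensions of a pure state form a closed face, because a convex combination restricting to an
  extreme point of the states on \<open>M\<close> has both of its members restricting to that point.
\<close>

theorem pure_state_extension:
  fixes M :: "'b::unital_cstar_algebra set"
  assumes M: "unital_subspace M" and \<omega>: "\<omega> \<in> pure_states M"
  shows "\<exists>\<psi>\<in>pure_states UNIV. restrict \<psi> M = \<omega>"
proof -
  let ?E = "{\<psi> \<in> states UNIV. restrict \<psi> M = \<omega>}"
  have \<omega>S: "\<omega> \<in> states M" using \<omega> by (simp add: pure_states_def)
  have \<omega>ext: "\<omega> \<in> extensional M"
    using states_functional[OF \<omega>S] by (simp add: linear_functionals_def)
  have iff: "restrict \<psi> M = \<omega> \<longleftrightarrow> (\<forall>x\<in>M. \<psi> x = \<omega> x)" for \<psi>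
    using \<omega>ext by (auto simp: restrict_def extensional_def fun_eq_iff)
  have "\<exists>\<psi>\<in>?E. \<psi> \<in> pure_states UNIV"
  proof (rule state_face_contains_pure_state)
    have "closed (\<Inter>x\<in>M. {\<psi>. \<psi> x = \<omega> x})"
      by (intro closed_INT ballI closed_Collect_eq continuous_on_const continuous_on_evaluation)
    with closed_states have "closed (states UNIV \<inter> (\<Inter>x\<in>M. {\<psi>. \<psi> x = \<omega> x}))"
      by (rule closed_Int)
    moreover have "?E = states UNIV \<inter> (\<Inter>x\<in>M. {\<psi>. \<psi> x = \<omega> x})"
      by (auto simp: iff)
    ultimately show "closed ?E" by simp
    show "?E \<noteq> {}" using state_extension[OF M \<omega>S] by blast
    show "state_face ?E"
      unfolding state_face_def
    proof (intro conjI ballI allI impI)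
      fix \<phi> \<psi> :: "'b \<Rightarrow> complex" and t :: real
      assume S: "\<phi> \<in> states UNIV" "\<psi> \<in> states UNIV" and t: "0 < t" "t < 1"
        and mem: "(\<lambda>x. complex_of_real (1 - t) * \<phi> x + complex_of_real t * \<psi> x) \<in> ?E"
      have eq: "\<omega> x = complex_of_real (1 - t) * \<phi> x + complex_of_real t * \<psi> x" if "x \<in> M" for x
        using mem that by (simp add: iff)
      have "restrict \<phi> M = restrict \<psi> M"
        using \<omega> t eq restrict_state[OF M S(1)] restrict_state[OF M S(2)]
        unfolding pure_states_def by auto
      then have "\<phi> x = \<psi> x" if "x \<in> M" for x
        using that by (metis restrict_apply')
      then have "\<forall>x\<in>M. \<phi> x = \<omega> x" "\<forall>x\<in>M. \<psi> x = \<omega> x"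
        using eq by (simp_all add: algebra_simps)
      with S show "\<phi> \<in> ?E" "\<psi> \<in> ?E" by (simp_all only: iff mem_Collect_eq simp_thms)
    qed auto
  qed
  then show ?thesis by blast
qed

section \<open>Generic uniqueness of support functionals\<close>

text \<open>
  Mazur's theorem for a function \<open>p\<close> on \<open>M\<close> and a family \<open>D\<close> of linear functionals below \<open>p\<close>. Two
  norms are in play in the application: completeness and separability refer to the ambient norm,
  support functionals to \<open>p\<close>, and the Lipschitz bound connects the two.
\<close>

locale dominated_functionals =
  fixes M :: "'a::banach set" and p :: "'a \<Rightarrow> real" and D :: "('a \<Rightarrow> real) set"
  assumes M: "subspace M"
    and lipschitz: "\<And>x y. x \<in> M \<Longrightarrow> y \<in> M \<Longrightarrow> \<bar>p x - p y\<bar> \<le> norm (x - y)"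
    and linear: "\<And>f x y r. f \<in> D \<Longrightarrow> x \<in> M \<Longrightarrow> y \<in> M \<Longrightarrow> f (x + r *\<^sub>R y) = f x + r * f y"
    and dominated: "\<And>f x. f \<in> D \<Longrightarrow> x \<in> M \<Longrightarrow> f x \<le> p x"
    and bounded: "\<And>f x. f \<in> D \<Longrightarrow> x \<in> M \<Longrightarrow> \<bar>f x\<bar> \<le> norm x"
begin

text \<open>
  The points at which all functionals that nearly attain \<open>p\<close> differ by less than \<open>e\<close> in the direction
  \<open>y\<close>. Near-attainment, rather than attainment, makes this set open without any compactness of \<open>D\<close>.
\<close>

definition almost_unique :: "'a \<Rightarrow> real \<Rightarrow> 'a set" where
  "almost_unique y e = {z \<in> M. \<exists>d>0. \<forall>f\<in>D. \<forall>g\<in>D. p z - d < f z \<longrightarrow> p z - d < g z \<longrightarrow> g y - f y < e}"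

lemma diff_le:
  assumes "f \<in> D" "x \<in> M" "y \<in> M"
  shows "\<bar>f x - f y\<bar> \<le> norm (x - y)"
  using linear[OF assms(1,3) subspace_diff[OF M assms(2,3)], of 1]
    bounded[OF assms(1) subspace_diff[OF M assms(2,3)]] by simp

lemma openin_almost_unique: "openin (top_of_set M) (almost_unique y e)"
  unfolding openin_euclidean_subtopology_iff
proof (intro conjI ballI)
  show "almost_unique y e \<subseteq> M" by (auto simp: almost_unique_def)
  fix z assume "z \<in> almost_unique y e"
  then obtain d where z: "z \<in> M" and d: "d > 0"
    and small: "\<And>f g. f \<in> D \<Longrightarrow> g \<in> D \<Longrightarrow> p z - d < f z \<Longrightarrow> p z - d < g z \<Longrightarrow> g y - f y < e"
    unfolding almost_unique_def by blast
  have "z' \<in> almost_unique y e" if z': "z' \<in> M" "dist z' z < d / 4" for z'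
  proof -
    have near: "norm (z' - z) < d / 4" using z' by (simp add: dist_norm)
    have "p z - d < f z" if "f \<in> D" "p z' - d / 2 < f z'" for f
      using diff_le[OF that(1) z'(1) z] lipschitz[OF z'(1) z] near that(2) by linarith
    then show ?thesis
      using z'(1) d small unfolding almost_unique_def
      by (intro CollectI conjI exI[of _ "d / 2"]) auto
  qed
  then show "\<exists>d>0. \<forall>z'\<in>M. dist z' z < d \<longrightarrow> z' \<in> almost_unique y e"
    using d by (intro exI[of _ "d / 4"]) auto
qed

text \<open>
  Along the line \<open>z + t y\<close> the value at \<open>y\<close> of a near-maximizing functional is almost nondecreasing in
  \<open>t\<close>, as for the slope of a convex function. If \<open>N + 1\<close> equally spaced points near \<open>z\<close> all failed to be
  almost unique, this value would increase by at least \<open>e / 2\<close> from each of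
  them to the next, which exceeds its total range \<open>2 norm y\<close> as soon as \<open>N\<close> is large.
\<close>

lemma almost_unique_dense:
  assumes z: "z \<in> M" and y: "y \<in> M" and e: "0 < e" and r: "0 < r"
  shows "\<exists>z'\<in>almost_unique y e. norm (z' - z) < r"
proof (rule ccontr)
  assume none: "\<not> ?thesis"
  obtain N :: nat where N: "2 * norm y < real N * (e / 2)"
    using reals_Archimedean3[OF half_gt_zero[OF e]] by blast
  define h where "h = r / (real (Suc N) * (norm y + 1))"
  have h: "0 < h"
    unfolding h_def using r by (intro divide_pos_pos mult_pos_pos add_nonneg_pos) auto
  \<comment> \<open>The tolerance costs at most \<open>2 d / h = e / 2\<close> of the gain \<open>e\<close> at each step.\<close>
  define d where "d = h * e / 4"
  have d: "0 < d" using h e by (simp add: d_def)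
  define s where "s j = z + (real j * h) *\<^sub>R y" for j
  have sM: "s j \<in> M" for j
    unfolding s_def using M z y by (intro subspace_add subspace_scale)
  have sr: "norm (s j - z) < r" if "j \<le> N" for j
  proof -
    have "norm (s j - z) = real j * h * norm y"
      using h by (simp add: s_def)
    also have "\<dots> \<le> real N * h * norm y"
      using that h by (intro mult_right_mono) auto
    also have "\<dots> < real (Suc N) * h * (norm y + 1)"
      using h by (simp add: algebra_simps add_pos_nonneg)
    also have "\<dots> = r"
    proof -
      have "real (Suc N) * (norm y + 1) > 0"
        by (intro mult_pos_pos add_nonneg_pos) auto
      moreover have "real (Suc N) * h * (norm y + 1) = h * (real (Suc N) * (norm y + 1))"
        by (simp only: mult_ac)
      ultimately show ?thesis
        unfolding h_def by (metis less_irrefl nonzero_eq_divide_eq)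
    qed
    finally show ?thesis .
  qed
  have "\<exists>f g. f \<in> D \<and> g \<in> D \<and> p (s j) - d < f (s j) \<and> p (s j) - d < g (s j) \<and> e \<le> g y - f y"
    if "j \<le> N" for j
    using none sr[OF that] sM[of j] d unfolding almost_unique_def by (force simp: not_less)
  then obtain F G where FG: "\<And>j. j \<le> N \<Longrightarrow> F j \<in> D" "\<And>j. j \<le> N \<Longrightarrow> G j \<in> D"
      "\<And>j. j \<le> N \<Longrightarrow> p (s j) - d < F j (s j)" "\<And>j. j \<le> N \<Longrightarrow> p (s j) - d < G j (s j)"
      "\<And>j. j \<le> N \<Longrightarrow> e \<le> G j y - F j y"
    by metis
  have step: "F j y + e / 2 \<le> F (Suc j) y" if "Suc j \<le> N" for j
  proof -
    have j: "j \<le> N" using that by simp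
    have s: "s (Suc j) = s j + h *\<^sub>R y"
      by (simp add: s_def algebra_simps)
    have "F (Suc j) (s (Suc j)) = F (Suc j) (s j) + h * F (Suc j) y"
         "G j (s (Suc j)) = G j (s j) + h * G j y"
      unfolding s using FG(1)[OF that] FG(2)[OF j] sM y by (simp_all add: linear)
    moreover have "G j (s (Suc j)) \<le> p (s (Suc j))" "F (Suc j) (s j) \<le> p (s j)"
      using FG(1)[OF that] FG(2)[OF j] sM by (simp_all add: dominated)
    ultimately have "h * G j y - h * F (Suc j) y \<le> 2 * d"
      using FG(3)[OF that] FG(4)[OF j] by linarith
    then have "h * (G j y - F (Suc j) y) \<le> h * (e / 2)"
      by (simp add: d_def algebra_simps)
    then have "G j y - F (Suc j) y \<le> e / 2"
      using h by simp
    with FG(5)[OF j] show ?thesis by linarith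
  qed
  have "F 0 y + real j * (e / 2) \<le> F j y" if "j \<le> N" for j
    using that
  proof (induction j)
    case (Suc j)
    then have "F 0 y + real j * (e / 2) \<le> F j y" by simp
    moreover have "real (Suc j) * (e / 2) = real j * (e / 2) + e / 2"
      by (simp add: field_simps)
    ultimately show ?case using step[OF Suc.prems] by linarith
  qed simp
  from this[of N] N bounded[OF FG(1)[of 0] y] bounded[OF FG(1)[of N] y]
  show False by simp
qed

text \<open>
  By Baire's theorem a dense set of points is almost unique for all members of a countable dense set of
  directions and for all tolerances \<open>1 / (n + 1)\<close> at once; there two maximizing functionals agree on the
  dense set and hence on \<open>M\<close>.
\<close>

theorem unique_support_functional_dense:
  assumes "closed M" "separable_space (top_of_set M)" and z: "z \<in> M" and r: "0 < r"
  shows "\<exists>z'\<in>M. norm (z' - z) < r \<and>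
    (\<forall>f\<in>D. \<forall>g\<in>D. f z' = p z' \<longrightarrow> g z' = p z' \<longrightarrow> (\<forall>y\<in>M. f y = g y))"
proof -
  obtain C where C: "countable C" "C \<subseteq> M" "top_of_set M closure_of C = M"
    using assms(2) by (auto simp: separable_space_def)
  define \<G> where "\<G> = (\<lambda>(y, n). almost_unique y (inverse (real (Suc n)))) ` (C \<times> UNIV)"
  have "top_of_set M closure_of \<Inter>\<G> = topspace (top_of_set M)"
  proof (rule Baire_category)
    show "completely_metrizable_space (top_of_set M) \<or>
        locally_compact_space (top_of_set M) \<and> regular_space (top_of_set M)"
      using completely_metrizable_space_closedin[OF completely_metrizable_space_euclidean, of M] assms(1)
      by simp
    show "countable \<G>" using C(1) by (auto simp: \<G>_def)
    fix T assume "T \<in> \<G>"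
    then obtain y n where y: "y \<in> C" and T: "T = almost_unique y (inverse (real (Suc n)))"
      by (auto simp: \<G>_def)
    have "x \<in> top_of_set M closure_of T" if x: "x \<in> M" for x
      unfolding in_closure_of
    proof (intro conjI allI impI)
      fix U assume U: "x \<in> U \<and> openin (top_of_set M) U"
      then obtain d where d: "d > 0" "\<And>x'. x' \<in> M \<Longrightarrow> dist x' x < d \<Longrightarrow> x' \<in> U"
        by (auto simp: openin_euclidean_subtopology_iff)
      obtain z' where "z' \<in> T" "norm (z' - x) < d"
        using almost_unique_dense[OF x, of y "inverse (real (Suc n))" d] y C(2) d(1) T by auto
      then show "\<exists>w. w \<in> T \<and> w \<in> U"
        using d(2)[of z'] T by (auto simp: dist_norm almost_unique_def)
    qed (use x in simp)
    then have "top_of_set M closure_of T = M"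
      using closure_of_subset_topspace[of "top_of_set M" T] by auto
    then show "openin (top_of_set M) T \<and> top_of_set M closure_of T = topspace (top_of_set M)"
      using openin_almost_unique T by simp
  qed
  then have "z \<in> top_of_set M closure_of \<Inter>\<G>" using z by simp
  moreover have "openin (top_of_set M) (M \<inter> ball z r)" by (simp add: openin_open_Int)
  ultimately obtain z' where z': "z' \<in> \<Inter>\<G>" "z' \<in> M" "z' \<in> ball z r"
    using z r unfolding in_closure_of by (metis Int_iff centre_in_ball)
  have "f y = g y" if f: "f \<in> D" "f z' = p z'" and g: "g \<in> D" "g z' = p z'" and y: "y \<in> M" for f g y
  proof -
    have le: "g c \<le> f c" if c: "c \<in> C" and f: "f \<in> D" "f z' = p z'" and g: "g \<in> D" "g z' = p z'" for f g c
    proof (rule ccontr)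
      assume "\<not> g c \<le> f c"
      then obtain n where n: "inverse (real (Suc n)) < g c - f c"
        using reals_Archimedean[of "g c - f c"] by auto
      have "z' \<in> almost_unique c (inverse (real (Suc n)))"
        using z'(1) c by (auto simp: \<G>_def)
      then show False
        using n f g unfolding almost_unique_def by fastforce
    qed
    have "\<bar>f y - g y\<bar> \<le> 0"
    proof (rule field_le_epsilon)
      fix e :: real assume e: "0 < e"
      have "y \<in> top_of_set M closure_of C" "openin (top_of_set M) (M \<inter> ball y (e / 2))"
        using y C(3) by (auto simp: openin_open_Int)
      then obtain c where c: "c \<in> C" "c \<in> ball y (e / 2)"
        using e y unfolding in_closure_of by (metis Int_iff centre_in_ball half_gt_zero)
      have "c \<in> M" using c C(2) by blast
      have "f c = g c" using le[OF c(1) f g] le[OF c(1) g f] by simp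
      moreover have "norm (y - c) < e / 2" using c(2) by (simp add: dist_norm)
      ultimately show "\<bar>f y - g y\<bar> \<le> 0 + e"
        using diff_le[OF f(1) y \<open>c \<in> M\<close>] diff_le[OF g(1) y \<open>c \<in> M\<close>] by linarith
    qed
    then show ?thesis by simp
  qed
  then show ?thesis
    using z' by (intro bexI[of _ z']) (auto simp: dist_norm norm_minus_commute)
qed

end

section \<open>Separating a pure state from finitely many slices\<close>

lemma functional_sum:
  assumes M: "unital_subspace M" and f: "f \<in> linear_functionals M" and "finite F" "F \<subseteq> M"
  shows "(\<Sum>y\<in>F. c y *\<^sub>C y) \<in> M \<and> f (\<Sum>y\<in>F. c y *\<^sub>C y) = (\<Sum>y\<in>F. c y * f y)"
  using assms(3,4)
proof (induction F)
  case empty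
  have "f 0 = 0" using functional_scaleC[OF f one_closed[OF M], of 0] by simp
  then show ?case using scaleC_closed[OF M one_closed[OF M], of 0] by simp
next
  case (insert y F)
  then show ?case
    using functional_add[OF f scaleC_closed[OF M, of y "c y"], of "\<Sum>y\<in>F. c y *\<^sub>C y"]
      functional_scaleC[OF f, of y "c y"] scaleC_closed[OF M, of y "c y"] add_closed[OF M]
    by simp
qed

text \<open>
  The first-order condition at a point of a convex set in a finite-dimensional Hilbert space that is
  closest to the origin: moving from the minimizer \<open>d\<close> towards another point \<open>e\<close> cannot decrease the
  distance, so the inner product of \<open>d\<close> and \<open>e\<close> is at least the square of the norm of \<open>d\<close>.
\<close>

lemma closest_point_variational:
  fixes d e :: "'i \<Rightarrow> complex"
  assumes min: "\<And>s::real. 0 < s \<Longrightarrow> s \<le> 1 \<Longrightarrow>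
      (\<Sum>y\<in>F. (cmod (d y))\<^sup>2) \<le> (\<Sum>y\<in>F. (cmod (d y + complex_of_real s * (e y - d y)))\<^sup>2)"
  shows "(\<Sum>y\<in>F. (cmod (d y))\<^sup>2) \<le> Re (\<Sum>y\<in>F. cnj (d y) * e y)"
proof -
  define A where "A = (\<Sum>y\<in>F. Re (cnj (d y) * (e y - d y)))"
  define R where "R = (\<Sum>y\<in>F. (cmod (e y - d y))\<^sup>2)"
  have R: "0 \<le> R" unfolding R_def by (intro sum_nonneg) simp
  have expand: "(cmod (a + complex_of_real s * b))\<^sup>2 = (cmod a)\<^sup>2 + (2 * s * Re (cnj a * b) + s\<^sup>2 * (cmod b)\<^sup>2)"
    for a b s by (simp only: cmod_power2) (simp add: power2_eq_square algebra_simps)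
  have "0 \<le> A"
  proof (rule ccontr)
    assume "\<not> 0 \<le> A"
    \<comment> \<open>For this \<open>s\<close> the quadratic term \<open>s R\<close> is at most half as large as the linear term \<open>2 A\<close>.\<close>
    define s where "s = min 1 (- A / (R + 1))"
    have s: "0 < s" "s \<le> 1" using \<open>\<not> 0 \<le> A\<close> R by (auto simp: s_def divide_less_0_iff)
    have "0 \<le> 2 * s * A + s\<^sup>2 * R"
      using min[OF s] unfolding expand sum.distrib A_def R_def by (simp add: sum_distrib_left)
    then have "0 \<le> s * (2 * A + s * R)" by (simp add: power2_eq_square algebra_simps)
    then have "0 \<le> 2 * A + s * R" using s(1) by (simp add: zero_le_mult_iff)
    moreover have "s * R \<le> - A"
    proof -
      have "s * R \<le> s * (R + 1)" using s by simp
      also have "\<dots> \<le> (- A / (R + 1)) * (R + 1)"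
        using R by (intro mult_right_mono) (auto simp: s_def)
      finally show ?thesis using R by simp
    qed
    ultimately show False using \<open>\<not> 0 \<le> A\<close> by linarith
  qed
  moreover have "Re (\<Sum>y\<in>F. cnj (d y) * e y) = (\<Sum>y\<in>F. (cmod (d y))\<^sup>2) + A"
    unfolding A_def cmod_power2 Re_sum sum.distrib[symmetric]
    by (intro sum.cong) (simp_all add: power2_eq_square algebra_simps)
  ultimately show ?thesis by simp
qed

text \<open>
  A convex combination of states \<open>\<phi> u\<close>, one from each slice \<open>r u \<le> Re (\<phi> u)\<close> with \<open>u \<in> V\<close>, is encoded
  by the tuple of its summands \<open>\<Psi> (u, _)\<close>, each of them a state multiplied by its weight
  \<open>\<Psi> (u, 1)\<close>. All conditions on weighted states are linear or norm inequalities without division, so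
  the tuples form a convex set that is closed under pointwise limits even where weights vanish; their sums
  are the convex hull of the slices.
\<close>

definition slice_tuples :: "('b::unital_cstar_algebra \<Rightarrow> real) \<Rightarrow> 'b set \<Rightarrow> ('b \<times> 'b \<Rightarrow> complex) set" where
  "slice_tuples r V = {\<Psi>. (\<forall>u x y. \<Psi> (u, x + y) = \<Psi> (u, x) + \<Psi> (u, y)) \<and>
     (\<forall>u c x. \<Psi> (u, c *\<^sub>C x) = c * \<Psi> (u, x)) \<and>
     (\<forall>u. Im (\<Psi> (u, 1)) = 0) \<and> (\<forall>u. 0 \<le> Re (\<Psi> (u, 1))) \<and>
     (\<forall>u x. cmod (\<Psi> (u, x)) \<le> Re (\<Psi> (u, 1)) * norm x) \<and>
     (\<forall>u. r u * Re (\<Psi> (u, 1)) \<le> Re (\<Psi> (u, u))) \<and>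
     (\<forall>u\<in>-V. \<Psi> (u, 1) = 0) \<and> (\<Sum>u\<in>V. \<Psi> (u, 1)) = 1}"

lemma slice_tuplesD:
  assumes "\<Psi> \<in> slice_tuples r V"
  shows "\<Psi> (u, x + y) = \<Psi> (u, x) + \<Psi> (u, y)" "\<Psi> (u, c *\<^sub>C x) = c * \<Psi> (u, x)"
    "\<Psi> (u, 1) = complex_of_real (Re (\<Psi> (u, 1)))" "0 \<le> Re (\<Psi> (u, 1))"
    "cmod (\<Psi> (u, x)) \<le> Re (\<Psi> (u, 1)) * norm x"
    "r u * Re (\<Psi> (u, 1)) \<le> Re (\<Psi> (u, u))"
    "u \<notin> V \<Longrightarrow> \<Psi> (u, 1) = 0" "(\<Sum>u\<in>V. \<Psi> (u, 1)) = 1"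
  using assms unfolding slice_tuples_def by (auto simp: complex_eq_iff)

lemma compact_slice_tuples:
  fixes V :: "'b::unital_cstar_algebra set"
  assumes "finite V"
  shows "compact (slice_tuples r V)"
proof (rule compact_of_pointwise_bound[where B = "\<lambda>ux. norm (snd ux)"])
  note intros = closed_Collect_all closed_Collect_eq closed_Collect_le continuous_on_add continuous_on_mult
    continuous_on_const continuous_on_norm continuous_on_Re continuous_on_Im continuous_on_sum
    continuous_on_evaluation
  have c: "closed {\<Psi>::'b \<times> 'b \<Rightarrow> complex. \<forall>u x y. \<Psi> (u, x + y) = \<Psi> (u, x) + \<Psi> (u, y)}"
    "closed {\<Psi>::'b \<times> 'b \<Rightarrow> complex. \<forall>u c x. \<Psi> (u, c *\<^sub>C x) = c * \<Psi> (u, x)}"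
    "closed {\<Psi>::'b \<times> 'b \<Rightarrow> complex. \<forall>u. Im (\<Psi> (u, 1)) = 0}"
    "closed {\<Psi>::'b \<times> 'b \<Rightarrow> complex. \<forall>u. 0 \<le> Re (\<Psi> (u, 1))}"
    "closed {\<Psi>::'b \<times> 'b \<Rightarrow> complex. \<forall>u x. cmod (\<Psi> (u, x)) \<le> Re (\<Psi> (u, 1)) * norm x}"
    "closed {\<Psi>::'b \<times> 'b \<Rightarrow> complex. \<forall>u. r u * Re (\<Psi> (u, 1)) \<le> Re (\<Psi> (u, u))}"
    "closed (\<Inter>u\<in>-V. {\<Psi>::'b \<times> 'b \<Rightarrow> complex. \<Psi> (u, 1) = 0})"
    "closed {\<Psi>::'b \<times> 'b \<Rightarrow> complex. (\<Sum>u\<in>V. \<Psi> (u, 1)) = 1}"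
    by (intro intros closed_INT ballI)+
  have eq: "slice_tuples r V = {\<Psi>. \<forall>u x y. \<Psi> (u, x + y) = \<Psi> (u, x) + \<Psi> (u, y)} \<inter>
     {\<Psi>. \<forall>u c x. \<Psi> (u, c *\<^sub>C x) = c * \<Psi> (u, x)} \<inter> {\<Psi>. \<forall>u. Im (\<Psi> (u, 1)) = 0} \<inter>
     {\<Psi>. \<forall>u. 0 \<le> Re (\<Psi> (u, 1))} \<inter> {\<Psi>. \<forall>u x. cmod (\<Psi> (u, x)) \<le> Re (\<Psi> (u, 1)) * norm x} \<inter>
     {\<Psi>. \<forall>u. r u * Re (\<Psi> (u, 1)) \<le> Re (\<Psi> (u, u))} \<inter> (\<Inter>u\<in>-V. {\<Psi>. \<Psi> (u, 1) = 0}) \<inter>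
     {\<Psi>. (\<Sum>u\<in>V. \<Psi> (u, 1)) = 1}"
    by (rule set_eqI) (simp add: slice_tuples_def)
  show "closed (slice_tuples r V)"
    unfolding eq by (intro closed_Int c)
  show "cmod (\<Psi> ux) \<le> norm (snd ux)" if \<Psi>: "\<Psi> \<in> slice_tuples r V" for \<Psi> and ux :: "'b \<times> 'b"
  proof -
    obtain u x where ux: "ux = (u, x)" by (rule prod.exhaust)
    have "Re (\<Psi> (u, 1)) \<le> 1"
    proof (cases "u \<in> V")
      case True
      have "Re (\<Psi> (u, 1)) \<le> (\<Sum>u\<in>V. Re (\<Psi> (u, 1)))"
        using slice_tuplesD(4)[OF \<Psi>] assms True by (intro member_le_sum) auto
      also have "\<dots> = 1"
        using arg_cong[OF slice_tuplesD(8)[OF \<Psi>], of Re] by (simp add: Re_sum)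
      finally show ?thesis .
    qed (simp add: slice_tuplesD(7)[OF \<Psi>])
    then have "Re (\<Psi> (u, 1)) * norm x \<le> 1 * norm x"
      by (rule mult_right_mono) simp
    with slice_tuplesD(5)[OF \<Psi>, of u x] show ?thesis by (simp add: ux)
  qed
qed

lemma slice_tuples_convex:
  assumes \<Psi>: "\<Psi> \<in> slice_tuples r V" and \<Theta>: "\<Theta> \<in> slice_tuples r V" and s: "0 \<le> s" "s \<le> 1"
  shows "(\<lambda>ux. complex_of_real (1 - s) * \<Psi> ux + complex_of_real s * \<Theta> ux) \<in> slice_tuples r V"
  unfolding slice_tuples_def
proof (intro CollectI conjI allI ballI)
  fix u x y and c :: complex
  let ?m = "\<lambda>ux. complex_of_real (1 - s) * \<Psi> ux + complex_of_real s * \<Theta> ux"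
  show "?m (u, x + y) = ?m (u, x) + ?m (u, y)"
    by (simp add: slice_tuplesD(1)[OF \<Psi>] slice_tuplesD(1)[OF \<Theta>] algebra_simps)
  show "?m (u, c *\<^sub>C x) = c * ?m (u, x)"
    by (simp add: slice_tuplesD(2)[OF \<Psi>] slice_tuplesD(2)[OF \<Theta>] algebra_simps)
  show "Im (?m (u, 1)) = 0"
    by (subst slice_tuplesD(3)[OF \<Psi>], subst slice_tuplesD(3)[OF \<Theta>]) simp
  show "0 \<le> Re (?m (u, 1))"
    using s slice_tuplesD(4)[OF \<Psi>, of u] slice_tuplesD(4)[OF \<Theta>, of u] by simp
  have "cmod (?m (u, x)) \<le> (1 - s) * cmod (\<Psi> (u, x)) + s * cmod (\<Theta> (u, x))"
    using s by (intro order_trans[OF norm_triangle_ineq]) (simp add: norm_mult del: of_real_diff)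
  also have "\<dots> \<le> (1 - s) * (Re (\<Psi> (u, 1)) * norm x) + s * (Re (\<Theta> (u, 1)) * norm x)"
    using s slice_tuplesD(5)[OF \<Psi>, of u x] slice_tuplesD(5)[OF \<Theta>, of u x]
    by (intro add_mono mult_left_mono) auto
  finally show "cmod (?m (u, x)) \<le> Re (?m (u, 1)) * norm x"
    by (simp add: algebra_simps)
  have "(1 - s) * (r u * Re (\<Psi> (u, 1))) + s * (r u * Re (\<Theta> (u, 1)))
      \<le> (1 - s) * Re (\<Psi> (u, u)) + s * Re (\<Theta> (u, u))"
    using s slice_tuplesD(6)[OF \<Psi>, of u] slice_tuplesD(6)[OF \<Theta>, of u]
    by (intro add_mono mult_left_mono) auto
  then show "r u * Re (?m (u, 1)) \<le> Re (?m (u, u))"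
    by (simp add: algebra_simps)
next
  fix u assume "u \<in> - V"
  then show "complex_of_real (1 - s) * \<Psi> (u, 1) + complex_of_real s * \<Theta> (u, 1) = 0"
    by (simp add: slice_tuplesD(7)[OF \<Psi>] slice_tuplesD(7)[OF \<Theta>])
next
  show "(\<Sum>u\<in>V. complex_of_real (1 - s) * \<Psi> (u, 1) + complex_of_real s * \<Theta> (u, 1)) = 1"
    by (simp add: sum.distrib slice_tuplesD(8)[OF \<Psi>] slice_tuplesD(8)[OF \<Theta>] flip: sum_distrib_left)
qed

lemma normalized_functional_state:
  assumes M: "unital_subspace M"
    and add: "\<And>x y. f (x + y) = f x + f y" and scale: "\<And>c x. f (c *\<^sub>C x) = c * f x"
    and one: "f 1 = complex_of_real t" and bound: "\<And>x. cmod (f x) \<le> t * norm x" and t: "0 < t"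
  shows "restrict (\<lambda>x. f x / complex_of_real t) M \<in> states M"
proof -
  let ?g = "restrict (\<lambda>x. f x / complex_of_real t) M"
  have "?g (x + y) = ?g x + ?g y" if "x \<in> M" "y \<in> M" for x y
    using that by (simp add: add_closed[OF M] add add_divide_distrib)
  moreover have "?g (c *\<^sub>C x) = c * ?g x" if "x \<in> M" for c x
    using that by (simp add: scaleC_closed[OF M] scale)
  moreover have "?g 1 = 1"
    using t by (simp add: one_closed[OF M] one)
  moreover have "cmod (?g x) \<le> norm x" if "x \<in> M" for x
    using that t bound[of x] by (simp add: norm_divide divide_le_eq mult.commute)
  ultimately show ?thesis
    by (simp add: states_def linear_functionals_def)
qed

text \<open>
  If a convex combination of states in the slices agreed with the extreme point \<open>\<omega>\<close> on \<open>M\<close>, any summand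
  of positive weight would be a multiple of \<open>\<omega>\<close> there, and \<open>\<omega>\<close> would lie in the corresponding
  slice.
\<close>

lemma pure_state_not_in_slice_hull:
  assumes M: "unital_subspace M" and \<omega>: "\<omega> \<in> pure_states M" and V: "finite V" "V \<subseteq> M"
    and r: "\<And>u. u \<in> V \<Longrightarrow> Re (\<omega> u) < r u" and \<Psi>: "\<Psi> \<in> slice_tuples r V"
  shows "\<exists>x\<in>M. (\<Sum>u\<in>V. \<Psi> (u, x)) \<noteq> \<omega> x"
proof (rule ccontr)
  assume "\<not> ?thesis"
  then have eq: "\<And>x. x \<in> M \<Longrightarrow> \<omega> x = (\<Sum>u\<in>V. \<Psi> (u, x))" by simp
  note D = slice_tuplesD[OF \<Psi>]
  have sum1: "(\<Sum>u\<in>V. Re (\<Psi> (u, 1))) = 1"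
    using arg_cong[OF D(8), of Re] by (simp add: Re_sum)
  obtain j where j: "j \<in> V" "0 < Re (\<Psi> (j, 1))"
  proof (rule ccontr)
    assume "\<not> thesis"
    with that have "\<And>u. u \<in> V \<Longrightarrow> Re (\<Psi> (u, 1)) \<le> 0" by (meson not_le)
    then have "(\<Sum>u\<in>V. Re (\<Psi> (u, 1))) \<le> 0" by (rule sum_nonpos)
    then show False using sum1 by simp
  qed
  define t where "t = Re (\<Psi> (j, 1))"
  define g where "g x = (\<Sum>u\<in>V - {j}. \<Psi> (u, x))" for x
  have split: "\<omega> x = \<Psi> (j, x) + g x" if "x \<in> M" for x
    unfolding eq[OF that] g_def using V(1) j(1) by (rule sum.remove)
  have rest1: "(\<Sum>u\<in>V - {j}. Re (\<Psi> (u, 1))) = 1 - t"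
    using sum1 sum.remove[OF V(1) j(1), of "\<lambda>u. Re (\<Psi> (u, 1))"] by (simp add: t_def)
  have g1: "g 1 = complex_of_real (1 - t)"
    unfolding g_def rest1[symmetric] of_real_sum using D(3) by (intro sum.cong) auto
  have gbound: "cmod (g x) \<le> (1 - t) * norm x" for x
    unfolding g_def rest1[symmetric] sum_distrib_right
    by (rule order_trans[OF norm_sum sum_mono]) (rule D(5))
  have "t \<le> 1" using rest1 sum_nonneg[of "V - {j}" "\<lambda>u. Re (\<Psi> (u, 1))"] D(4) by simp
  \<comment> \<open>The complementary part \<open>g\<close> can be normalized to a state only if its weight \<open>1 - t\<close> is positive.\<close>
  have "complex_of_real t * \<omega> j = \<Psi> (j, j)"
  proof (cases "t = 1")
    case True
    then show ?thesis using split[of j] gbound[of j] j V by auto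
  next
    case False
    then have t: "0 < t" "t < 1" using \<open>t \<le> 1\<close> j by (auto simp: t_def)
    let ?\<phi> = "restrict (\<lambda>x. g x / complex_of_real (1 - t)) M"
    let ?\<psi> = "restrict (\<lambda>x. \<Psi> (j, x) / complex_of_real t) M"
    have "?\<phi> \<in> states M"
      using t gbound by (intro normalized_functional_state[OF M, where f = g and t = "1 - t"])
        (simp_all only: g1, simp_all add: g_def D(1,2) sum.distrib sum_distrib_left)
    moreover have "?\<psi> \<in> states M"
      using t D(3)[of j] D(5)[of j]
      by (intro normalized_functional_state[OF M, where f = "\<lambda>x. \<Psi> (j, x)" and t = t])
        (simp_all add: D(1,2) t_def)
    moreover have "\<forall>x\<in>M. \<omega> x = complex_of_real (1 - t) * ?\<phi> x + complex_of_real t * ?\<psi> x"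
      using t split by (simp add: add.commute del: of_real_diff)
    ultimately have "?\<phi> = ?\<psi>"
      using \<omega> t unfolding pure_states_def by blast
    then have "?\<phi> j = ?\<psi> j" by (rule fun_cong)
    then have "g j / complex_of_real (1 - t) = \<Psi> (j, j) / complex_of_real t"
      using j V by auto
    then have "complex_of_real t * g j = complex_of_real (1 - t) * \<Psi> (j, j)"
      using t by (simp add: field_simps del: of_real_diff)
    then show ?thesis
      using split[of j] j V by (auto simp: algebra_simps)
  qed
  from arg_cong[OF this, of Re] have "Re (\<Psi> (j, j)) = t * Re (\<omega> j)" by simp
  then show False
    using D(6)[of j] r[OF j(1)] j(2) by (simp add: t_def mult.commute)
qed

text \<open>
  By compactness finitely many points of \<open>M\<close> already distinguish \<open>\<omega>\<close> from every element of the hull.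
  On these points the hull has a member closest to \<open>\<omega>\<close>, at positive squared distance \<open>\<delta>\<close>, and its
  difference from \<open>\<omega>\<close> gives the coefficients of the separating \<open>y\<close>.
\<close>

theorem pure_state_slice_separation:
  fixes M :: "'b::unital_cstar_algebra set"
  assumes M: "unital_subspace M" and \<omega>: "\<omega> \<in> pure_states M" and V: "finite V" "V \<subseteq> M"
    and r: "\<And>u. u \<in> V \<Longrightarrow> Re (\<omega> u) < r u"
  shows "\<exists>y\<in>M. \<exists>\<delta>>0. \<forall>\<phi>\<in>states UNIV. \<forall>u\<in>V. r u \<le> Re (\<phi> u) \<longrightarrow> Re (\<phi> y) \<le> Re (\<omega> y) - \<delta>"
proof -
  let ?X = "slice_tuples r V"
  let ?T = "\<lambda>(\<Psi> :: 'b \<times> 'b \<Rightarrow> complex) x. \<Sum>u\<in>V. \<Psi> (u, x)"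
  have \<omega>lin: "\<omega> \<in> linear_functionals M"
    using \<omega> by (simp add: pure_states_def states_def)
  have inX: "(\<lambda>vx. if fst vx = u then \<phi> (snd vx) else 0) \<in> ?X"
    if "\<phi> \<in> states UNIV" "u \<in> V" "r u \<le> Re (\<phi> u)" for \<phi> u
    using that states_functional[OF that(1)] states_bound[OF that(1)] V(1)
    by (auto simp: slice_tuples_def functional_add functional_scaleC states_one)
  show ?thesis
  proof (cases "?X = {}")
    case True
    \<comment> \<open>All slices are empty, so every \<open>y\<close> separates vacuously.\<close>
    then show ?thesis
      using inX one_closed[OF M] by (intro bexI[of _ 1] exI[of _ 1]) auto
  next
    case False
    have contT: "continuous_on S (\<lambda>\<Psi>. ?T \<Psi> x)" for S x
      by (intro continuous_on_sum continuous_on_evaluation)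
    have opn: "open {\<Psi>. ?T \<Psi> x \<noteq> \<omega> x}" for x
      by (intro open_Collect_neq contT continuous_on_const)
    have cover: "?X \<subseteq> (\<Union>x\<in>M. {\<Psi>. ?T \<Psi> x \<noteq> \<omega> x})"
      using pure_state_not_in_slice_hull[OF M \<omega> V r] by blast
    obtain F where F: "F \<subseteq> M" "finite F" "?X \<subseteq> (\<Union>x\<in>F. {\<Psi>. ?T \<Psi> x \<noteq> \<omega> x})"
      by (rule compactE_image[OF compact_slice_tuples[OF V(1)] opn cover])
    define Q where "Q \<Psi> = (\<Sum>x\<in>F. (cmod (?T \<Psi> x - \<omega> x))\<^sup>2)" for \<Psi>
    have "continuous_on ?X Q"
      unfolding Q_def
      by (intro continuous_on_sum continuous_on_power continuous_on_norm continuous_on_diff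
          continuous_on_evaluation continuous_on_const)
    then obtain \<Theta> where \<Theta>: "\<Theta> \<in> ?X" "\<And>\<Psi>. \<Psi> \<in> ?X \<Longrightarrow> Q \<Theta> \<le> Q \<Psi>"
      using continuous_attains_inf[OF compact_slice_tuples[OF V(1)] False] by blast
    define d where "d x = ?T \<Theta> x - \<omega> x" for x
    have Q\<Theta>: "Q \<Theta> = (\<Sum>x\<in>F. (cmod (d x))\<^sup>2)" by (simp add: Q_def d_def)
    obtain x where "x \<in> F" "d x \<noteq> 0" using F(3) \<Theta>(1) by (auto simp: d_def)
    then have pos: "0 < Q \<Theta>"
      unfolding Q\<Theta> using F(2) by (intro sum_pos2[of F x]) auto
    define y where "y = (\<Sum>x\<in>F. (- cnj (d x)) *\<^sub>C x)"
    have y: "y \<in> M" "\<omega> y = (\<Sum>x\<in>F. - cnj (d x) * \<omega> x)"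
      using functional_sum[OF M \<omega>lin F(2,1), of "\<lambda>x. - cnj (d x)"] by (simp_all add: y_def)
    have "Re (\<phi> y) \<le> Re (\<omega> y) - Q \<Theta>"
      if \<phi>: "\<phi> \<in> states UNIV" and u: "u \<in> V" "r u \<le> Re (\<phi> u)" for \<phi> u
    proof -
      define \<Phi> where "\<Phi> = (\<lambda>vx. if fst vx = u then \<phi> (snd vx) else 0)"
      have \<Phi>: "\<Phi> \<in> ?X" unfolding \<Phi>_def by (rule inX[OF \<phi> u])
      have T\<Phi>: "?T \<Phi> x = \<phi> x" for x using V(1) u(1) by (simp add: \<Phi>_def)
      have bound: "Q \<Theta> \<le> Re (\<Sum>x\<in>F. cnj (d x) * (\<phi> x - \<omega> x))"
        unfolding Q\<Theta>
      proof (rule closest_point_variational)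
        fix s :: real assume s: "0 < s" "s \<le> 1"
        let ?m = "\<lambda>ux. complex_of_real (1 - s) * \<Theta> ux + complex_of_real s * \<Phi> ux"
        have "?T ?m x - \<omega> x = d x + complex_of_real s * (\<phi> x - \<omega> x - d x)" for x
        proof -
          have "?T ?m x = complex_of_real (1 - s) * ?T \<Theta> x + complex_of_real s * ?T \<Phi> x"
            by (simp only: sum.distrib sum_distrib_left)
          also have "?T \<Phi> x = \<phi> x" by (rule T\<Phi>)
          finally show ?thesis by (simp add: d_def algebra_simps)
        qed
        then have "Q ?m = (\<Sum>x\<in>F. (cmod (d x + complex_of_real s * (\<phi> x - \<omega> x - d x)))\<^sup>2)"
          by (simp add: Q_def)
        then show "(\<Sum>x\<in>F. (cmod (d x))\<^sup>2) \<le> (\<Sum>x\<in>F. (cmod (d x + complex_of_real s * (\<phi> x - \<omega> x - d x)))\<^sup>2)"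
          using \<Theta>(2)[OF slice_tuples_convex[OF \<Theta>(1) \<Phi>, of s]] s Q\<Theta> by simp
      qed
      have "\<phi> y = (\<Sum>x\<in>F. - cnj (d x) * \<phi> x)"
        using functional_sum[OF unital_subspace_UNIV states_functional[OF \<phi>] F(2), of "\<lambda>x. - cnj (d x)"]
        by (simp add: y_def)
      then have "\<phi> y - \<omega> y = - (\<Sum>x\<in>F. cnj (d x) * (\<phi> x - \<omega> x))"
        by (simp add: y(2) right_diff_distrib sum_subtractf sum_negf)
      from arg_cong[OF this, of Re]
      have "Re (\<phi> y) - Re (\<omega> y) = - Re (\<Sum>x\<in>F. cnj (d x) * (\<phi> x - \<omega> x))"
        by (simp only: minus_complex.sel uminus_complex.sel)
      with bound show ?thesis by linarith
    qed
    then show ?thesis using y(1) pos by blast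
  qed
qed

section \<open>Numerical radius\<close>

lemma state_le_numerical_radius:
  assumes "\<psi> \<in> states UNIV"
  shows "cmod (\<psi> b) \<le> numerical_radius b"
  unfolding numerical_radius_def
proof (rule cSUP_upper[OF assms bdd_aboveI2])
  show "cmod (\<phi> b) \<le> norm b" if "\<phi> \<in> states UNIV" for \<phi>
    by (rule states_bound[OF that UNIV_I])
qed

lemma numerical_radius_attained:
  assumes "states UNIV \<noteq> ({} :: ('b::unital_cstar_algebra \<Rightarrow> complex) set)"
  shows "\<exists>\<psi>\<in>states UNIV. cmod (\<psi> (b::'b)) = numerical_radius b"
proof -
  obtain \<psi> where \<psi>: "\<psi> \<in> states UNIV" "\<And>\<phi>. \<phi> \<in> states UNIV \<Longrightarrow> cmod (\<phi> b) \<le> cmod (\<psi> b)"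
    using continuous_attains_sup[OF compact_states assms
        continuous_on_norm[OF continuous_on_evaluation[of _ b]]] by blast
  then have "numerical_radius b \<le> cmod (\<psi> b)"
    unfolding numerical_radius_def by (intro cSUP_least) auto
  with state_le_numerical_radius[OF \<psi>(1)] \<psi>(1) show ?thesis
    by (intro bexI[of _ \<psi>] antisym)
qed

text \<open>
  The numerical radius is a supremum over states on the whole algebra, but it also bounds the states
  on \<open>M\<close>, since these extend.
\<close>

lemma substate_le_numerical_radius:
  assumes M: "unital_subspace M" and \<phi>: "\<phi> \<in> states M" and y: "y \<in> M"
  shows "cmod (\<phi> y) \<le> numerical_radius y"
proof -
  obtain \<psi> where \<psi>: "\<psi> \<in> states UNIV" "restrict \<psi> M = \<phi>"
    using state_extension[OF M \<phi>] by blast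
  then have "\<phi> y = \<psi> y" using y by auto
  then show ?thesis using state_le_numerical_radius[OF \<psi>(1)] by simp
qed

text \<open>
  If there are no states, as in the zero algebra, the numerical radius is the supremum of the empty set
  and has no usable properties.
\<close>

context
  assumes nonempty: "states UNIV \<noteq> ({} :: ('b::unital_cstar_algebra \<Rightarrow> complex) set)"
begin

lemma numerical_radius_le_norm: "numerical_radius (b::'b) \<le> norm b"
proof -
  obtain \<psi> where "\<psi> \<in> states UNIV" "cmod (\<psi> b) = numerical_radius b"
    using numerical_radius_attained[OF nonempty] by blast
  then show ?thesis using states_bound[of \<psi> UNIV b] by auto
qed

lemma numerical_radius_nonneg: "0 \<le> numerical_radius (b::'b)"
  using numerical_radius_attained[OF nonempty, of b] norm_ge_zero by metis

lemma numerical_radius_le_add: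
  "numerical_radius (x::'b) \<le> numerical_radius y + norm (x - y)"
proof -
  obtain \<psi> where \<psi>: "\<psi> \<in> states UNIV" "cmod (\<psi> x) = numerical_radius x"
    using numerical_radius_attained[OF nonempty] by blast
  have "\<psi> x = \<psi> y + \<psi> (x - y)"
    using functional_add[OF states_functional[OF \<psi>(1)], of y "x - y"] by simp
  then have "cmod (\<psi> x) \<le> cmod (\<psi> y) + cmod (\<psi> (x - y))"
    by (simp add: norm_triangle_ineq)
  with \<psi>(2) state_le_numerical_radius[OF \<psi>(1), of y] states_bound[OF \<psi>(1), of "x - y"]
  show ?thesis by auto
qed

lemma numerical_radius_lipschitz:
  "\<bar>numerical_radius (x::'b) - numerical_radius y\<bar> \<le> norm (x - y)"
  using numerical_radius_le_add[of x y] numerical_radius_le_add[of y x]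
  by (simp add: norm_minus_commute)

lemma numerical_radius_scaleC: "numerical_radius (c *\<^sub>C (x::'b)) = cmod c * numerical_radius x"
proof (rule antisym)
  have eq: "cmod (\<psi> (c *\<^sub>C x)) = cmod c * cmod (\<psi> x)" if "\<psi> \<in> states UNIV" for \<psi>
    using functional_scaleC[OF states_functional[OF that], of x c] by (simp add: norm_mult)
  obtain \<psi> where "\<psi> \<in> states UNIV" "cmod (\<psi> (c *\<^sub>C x)) = numerical_radius (c *\<^sub>C x)"
    using numerical_radius_attained[OF nonempty] by blast
  then show "numerical_radius (c *\<^sub>C x) \<le> cmod c * numerical_radius x"
    using eq state_le_numerical_radius[of \<psi> x] by (metis mult_left_mono norm_ge_zero)
  obtain \<phi> where "\<phi> \<in> states UNIV" "cmod (\<phi> x) = numerical_radius x"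
    using numerical_radius_attained[OF nonempty] by blast
  then show "cmod c * numerical_radius x \<le> numerical_radius (c *\<^sub>C x)"
    using eq state_le_numerical_radius[of \<phi> "c *\<^sub>C x"] by metis
qed

section \<open>Smooth points\<close>

text \<open>
  Boundedness makes a functional vanish where the numerical radius does, so the
  pointwise bound holds there too; elsewhere it follows from the dual norm by scaling.
\<close>

lemma norm_one_functional_iff:
  assumes M: "unital_subspace M" and x: "(x::'b) \<in> M" and nx: "numerical_radius x = 1"
  shows "f \<in> bounded_functionals numerical_radius M \<and> functional_norm numerical_radius M f = 1 \<and> f x = 1
    \<longleftrightarrow> f \<in> linear_functionals M \<and> (\<forall>y\<in>M. cmod (f y) \<le> numerical_radius y) \<and> f x = 1"
proof (safe, goal_cases)
  case 1
  then show ?case by (simp add: bounded_functionals_def)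
next
  case (2 y)
  then obtain K where f: "f \<in> linear_functionals M" and K: "\<And>y. y \<in> M \<Longrightarrow> cmod (f y) \<le> K * numerical_radius y"
    by (auto simp: bounded_functionals_def)
  have bdd: "bdd_above ((\<lambda>y. cmod (f y)) ` {y \<in> M. numerical_radius y \<le> 1})"
  proof (rule bdd_aboveI2)
    fix y assume y: "y \<in> {y \<in> M. numerical_radius y \<le> 1}"
    have "cmod (f y) \<le> K * numerical_radius y" using K y by simp
    also have "\<dots> \<le> \<bar>K\<bar> * numerical_radius y"
      using numerical_radius_nonneg by (intro mult_right_mono) auto
    also have "\<dots> \<le> \<bar>K\<bar> * 1" using y by (intro mult_left_mono) auto
    finally show "cmod (f y) \<le> \<bar>K\<bar>" by simp
  qed
  show ?case
  proof (cases "numerical_radius y = 0")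
    case True
    then show ?thesis using K[OF 2(4)] by simp
  next
    case False
    then have pos: "0 < numerical_radius y" using numerical_radius_nonneg[of y] by simp
    let ?c = "complex_of_real (1 / numerical_radius y)"
    have "numerical_radius (?c *\<^sub>C y) = 1"
      using pos by (simp add: numerical_radius_scaleC norm_divide)
    then have "cmod (f (?c *\<^sub>C y)) \<le> functional_norm numerical_radius M f"
      unfolding functional_norm_def using scaleC_closed[OF M 2(4)]
      by (intro cSUP_upper[OF _ bdd]) auto
    moreover have "cmod (f (?c *\<^sub>C y)) = cmod (f y) / numerical_radius y"
      using pos functional_scaleC[OF f 2(4), of ?c] by (simp add: norm_mult norm_divide)
    ultimately show ?thesis
      using 2(2) pos by (simp add: divide_le_eq)
  qed
next
  case 3
  then show ?case by (auto simp: bounded_functionals_def intro!: exI[of _ 1])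
next
  case 4
  show ?case
    unfolding functional_norm_def
  proof (rule cSup_eq_maximum)
    show "1 \<in> (\<lambda>y. cmod (f y)) ` {y \<in> M. numerical_radius y \<le> 1}"
      using x nx 4 by (intro image_eqI[of _ _ x]) auto
  qed (use 4 in \<open>auto intro: order_trans\<close>)
qed

lemma smooth_points_iff:
  assumes M: "unital_subspace M"
  shows "(x::'b) \<in> smooth_points numerical_radius M \<longleftrightarrow> x \<in> M \<and> numerical_radius x = 1 \<and>
    (\<exists>!f. f \<in> linear_functionals M \<and> (\<forall>y\<in>M. cmod (f y) \<le> numerical_radius y) \<and> f x = 1)"
  unfolding smooth_points_def using norm_one_functional_iff[OF M] by (simp cong: conj_cong)

end

text \<open>
  A state of modulus one at \<open>x\<close> becomes a support functional at \<open>x\<close> after division by its phase there,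
  and the value at the unit remembers that phase.
\<close>

lemma rotated_state_functional:
  assumes M: "unital_subspace M" and \<phi>: "\<phi> \<in> states M" and x: "x \<in> M" and m: "cmod (\<phi> x) = 1"
  defines "f \<equiv> restrict (\<lambda>y. cnj (\<phi> x) * \<phi> y) M"
  shows "f \<in> linear_functionals M" "\<And>y. y \<in> M \<Longrightarrow> cmod (f y) \<le> numerical_radius y" "f x = 1"
    "f 1 = cnj (\<phi> x)"
proof -
  note lin = states_functional[OF \<phi>]
  show "f \<in> linear_functionals M"
    using functional_add[OF lin] functional_scaleC[OF lin] scaleC_closed[OF M] add_closed[OF M]
    by (auto simp: f_def linear_functionals_def algebra_simps)
  show "cmod (f y) \<le> numerical_radius y" if "y \<in> M" for y
    using substate_le_numerical_radius[OF M \<phi> that] that m by (simp add: f_def norm_mult)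
  show "f x = 1"
    using x m complex_norm_square[of "\<phi> x"] by (simp add: f_def mult.commute)
  show "f 1 = cnj (\<phi> x)"
    using one_closed[OF M] states_one[OF \<phi>] by (simp add: f_def)
qed

lemma states_nonempty:
  fixes M :: "'b::unital_cstar_algebra set"
  assumes "unital_subspace M" "\<phi> \<in> states M"
  shows "states UNIV \<noteq> ({} :: ('b \<Rightarrow> complex) set)"
  using state_extension[OF assms] by blast

lemma smooth_point_unique_state:
  assumes M: "unital_subspace M" and x: "x \<in> smooth_points numerical_radius M"
    and \<phi>: "\<phi> \<in> states M" "cmod (\<phi> x) = 1" and \<psi>: "\<psi> \<in> states M" "cmod (\<psi> x) = 1"
  shows "\<phi> = \<psi>"
proof -
  note sm = x[unfolded smooth_points_iff[OF states_nonempty[OF M \<phi>(1)] M]]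
  have xM: "x \<in> M" using sm by blast
  note f = rotated_state_functional[OF M \<phi>(1) xM \<phi>(2)]
  note g = rotated_state_functional[OF M \<psi>(1) xM \<psi>(2)]
  have eq: "restrict (\<lambda>y. cnj (\<phi> x) * \<phi> y) M = restrict (\<lambda>y. cnj (\<psi> x) * \<psi> y) M"
  proof -
    have ex1_eq: "a = b" if "\<exists>!h. P h" "P a" "P b" for P and a b :: "'a \<Rightarrow> complex"
      using that by blast
    from sm have "\<exists>!f. f \<in> linear_functionals M \<and> (\<forall>y\<in>M. cmod (f y) \<le> numerical_radius y) \<and> f x = 1"
      by (elim conjE)
    then show ?thesis
      by (rule ex1_eq) (intro conjI ballI f(1-3) g(1-3); assumption)+
  qed
  have phase: "cnj (\<phi> x) = cnj (\<psi> x)"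
    using f(4) g(4) unfolding eq by simp
  have "cnj (\<psi> x) \<noteq> 0" using \<psi>(2) by auto
  show ?thesis
  proof (rule functional_eqI[OF states_functional[OF \<phi>(1)] states_functional[OF \<psi>(1)]])
    fix y assume "y \<in> M"
    then have "cnj (\<phi> x) * \<phi> y = cnj (\<psi> x) * \<psi> y"
      using fun_cong[OF eq, of y] by simp
    then show "\<phi> y = \<psi> y"
      using phase \<open>cnj (\<psi> x) \<noteq> 0\<close> by simp
  qed
qed

section \<open>Purity and peak sets\<close>

text \<open>
  In a convex combination of modulus one at \<open>x\<close>, both members must have modulus one at \<open>x\<close>, and so both
  are \<open>\<phi>\<close>.
\<close>

lemma exposed_state_pure:
  assumes \<phi>: "\<phi> \<in> states M" "cmod (\<phi> x) = 1" and x: "x \<in> M"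
    and le: "\<And>\<theta>. \<theta> \<in> states M \<Longrightarrow> cmod (\<theta> x) \<le> 1"
    and unique: "\<And>\<theta>. \<theta> \<in> states M \<Longrightarrow> cmod (\<theta> x) = 1 \<Longrightarrow> \<theta> = \<phi>"
  shows "\<phi> \<in> pure_states M"
  unfolding pure_states_def
proof (intro CollectI conjI ballI allI impI)
  fix \<theta> \<psi> :: "'a \<Rightarrow> complex" and t :: real
  assume S: "\<theta> \<in> states M" "\<psi> \<in> states M" and t: "0 < t" "t < 1"
    and eq: "\<forall>x\<in>M. \<phi> x = complex_of_real (1 - t) * \<theta> x + complex_of_real t * \<psi> x"
  have "1 \<le> (1 - t) * cmod (\<theta> x) + t * cmod (\<psi> x)"
    using norm_triangle_ineq[of "complex_of_real (1 - t) * \<theta> x" "complex_of_real t * \<psi> x"]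
      eq x \<phi>(2) t by (simp add: norm_mult del: of_real_diff)
  from convex_combination_eq_max[OF t le[OF S(1)] le[OF S(2)] this]
  show "\<theta> = \<psi>" using unique S by metis
qed (rule \<phi>(1))

lemma smooth_state_pure:
  assumes M: "unital_subspace M" and x: "x \<in> smooth_points numerical_radius M"
    and \<phi>: "\<phi> \<in> states M" "cmod (\<phi> x) = 1"
  shows "\<phi> \<in> pure_states M"
proof -
  have x': "x \<in> M" "numerical_radius x = 1" using x by (auto simp: smooth_points_def)
  show ?thesis
    using substate_le_numerical_radius[OF M _ x'(1)] smooth_point_unique_state[OF M x _ _ \<phi>] x'
    by (intro exposed_state_pure[OF \<phi> x'(1)]) auto
qed

lemma pure_states_state: "\<omega> \<in> pure_states M \<Longrightarrow> \<omega> \<in> states M"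
  by (simp add: pure_states_def)

text \<open>
  The peak set is the whole set of extensions of \<open>\<omega>\<close> restricted to \<open>M\<close>, and the peaking element is \<open>x\<close>
  rotated so that \<open>\<omega>\<close> takes the value one. A state of modulus one there agrees with \<open>\<omega>\<close> on \<open>M\<close> by
  smoothness.
\<close>

lemma smooth_pure_states_subset_peak:
  assumes M: "unital_subspace M"
  shows "smooth_pure_states M \<subseteq> peak_pure_states M"
proof
  fix \<omega> assume "\<omega> \<in> smooth_pure_states M"
  then obtain x where \<omega>: "\<omega> \<in> pure_states UNIV" and x: "x \<in> smooth_points numerical_radius M"
    and m: "cmod (\<omega> x) = 1"
    by (auto simp: smooth_pure_states_def)
  have xM: "x \<in> M" "numerical_radius x = 1" using x by (auto simp: smooth_points_def)
  let ?E = "state_extensions M \<omega>" and ?x = "cnj (\<omega> x) *\<^sub>C x"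
  note \<omega>S = pure_states_state[OF \<omega>]
  have val: "\<psi> ?x = cnj (\<omega> x) * \<psi> x" if "\<psi> \<in> states UNIV" for \<psi>
    using functional_scaleC[OF states_functional[OF that]] by simp
  have "\<phi> ?x = 1" if "\<phi> \<in> ?E" for \<phi>
  proof -
    have "\<phi> x = \<omega> x" "\<phi> \<in> states UNIV"
      using that xM(1) by (auto simp: state_extensions_def dest!: fun_cong[of _ _ x])
    then show ?thesis using val[of \<phi>] m complex_norm_square[of "\<omega> x"] by (simp add: mult.commute)
  qed
  moreover have "cmod (\<psi> ?x) < 1" if "\<psi> \<in> states UNIV - ?E" for \<psi>
  proof -
    have \<psi>: "\<psi> \<in> states UNIV" using that by blast
    have "cmod (\<psi> x) \<noteq> 1"
    proof
      assume "cmod (\<psi> x) = 1"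
      then have "restrict \<psi> M = restrict \<omega> M"
        using smooth_point_unique_state[OF M x restrict_state[OF M \<psi>] _ restrict_state[OF M \<omega>S]] xM(1) m
        by simp
      then show False using that \<psi> by (simp add: state_extensions_def)
    qed
    then have "cmod (\<psi> x) < 1"
      using state_le_numerical_radius[OF \<psi>, of x] xM(2) by simp
    then show ?thesis using val[OF \<psi>] m by (simp add: norm_mult)
  qed
  ultimately have "peak_set M ?E"
    unfolding peak_set_def using scaleC_closed[OF M xM(1)]
    by (intro conjI bexI[of _ ?x]) (auto simp: state_extensions_def)
  moreover have "\<omega> \<in> ?E" using \<omega>S by (simp add: state_extensions_def)
  ultimately show "\<omega> \<in> peak_pure_states M"
    using \<omega> by (auto simp: peak_pure_states_def)
qed

text \<open>
  Any state on \<open>M\<close> of modulus one at the peaking element has its extensions in the peak set, all of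
  whose members agree with \<open>\<omega>\<close> on \<open>M\<close>; so \<open>\<omega>\<close> is exposed on \<open>M\<close>.
\<close>

lemma peak_pure_states_restrict:
  assumes M: "unital_subspace M" and \<omega>: "\<omega> \<in> peak_pure_states M"
  shows "restrict \<omega> M \<in> pure_states M"
proof -
  obtain E x where \<omega>P: "\<omega> \<in> pure_states UNIV" and E: "E \<noteq> {}" "E \<subseteq> state_extensions M \<omega>"
    and x: "x \<in> M" "\<And>\<phi>. \<phi> \<in> E \<Longrightarrow> \<phi> x = 1" "\<And>\<psi>. \<psi> \<in> states UNIV - E \<Longrightarrow> cmod (\<psi> x) < 1"
    using \<omega> unfolding peak_pure_states_def peak_set_def by blast
  have eqE: "restrict \<phi> M = restrict \<omega> M" if "\<phi> \<in> E" for \<phi>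
    using that E(2) by (auto simp: state_extensions_def)
  obtain \<phi> where "\<phi> \<in> E" using E(1) by blast
  then have \<omega>x: "restrict \<omega> M x = 1"
    using x(1,2) eqE[of \<phi>] by (metis restrict_apply')
  show ?thesis
  proof (rule exposed_state_pure[OF _ _ x(1)])
    show "restrict \<omega> M \<in> states M"
      by (rule restrict_state[OF M pure_states_state[OF \<omega>P]])
    show "cmod (restrict \<omega> M x) = 1" using \<omega>x by simp
    fix \<theta> assume "\<theta> \<in> states M"
    then obtain \<psi> where \<psi>: "\<psi> \<in> states UNIV" "restrict \<psi> M = \<theta>"
      using state_extension[OF M] by blast
    then have val: "\<theta> x = \<psi> x" using x(1) by auto
    show "cmod (\<theta> x) \<le> 1"
      using val x(2)[of \<psi>] x(3)[of \<psi>] \<psi>(1) by (cases "\<psi> \<in> E") auto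
    show "\<theta> = restrict \<omega> M" if "cmod (\<theta> x) = 1"
    proof -
      have "\<psi> \<in> E" using that val x(3)[of \<psi>] \<psi>(1) by auto
      then show ?thesis using eqE \<psi>(2) by simp
    qed
  qed
qed

section \<open>Density of the smooth pure states\<close>

lemma weak_star_denseI:
  assumes A: "A \<subseteq> pure_states M"
    and approx: "\<And>\<omega> Y e. \<omega> \<in> pure_states M \<Longrightarrow> finite Y \<Longrightarrow> Y \<subseteq> M \<Longrightarrow> 0 < e \<Longrightarrow>
      \<exists>\<alpha>\<in>A. \<forall>y\<in>Y. cmod (\<alpha> y - \<omega> y) < e"
  shows "weak_star_dense_in_pure_states M A"
proof -
  let ?X = "subtopology (weak_star M) (pure_states M)"
  have ext: "\<omega> \<in> extensional M" if "\<omega> \<in> pure_states M" for \<omega>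
    using states_functional[OF pure_states_state[OF that]] by (simp add: linear_functionals_def)
  have "topspace ?X = pure_states M"
  proof -
    have "pure_states M \<subseteq> extensional M \<inter> states M"
      using ext pure_states_state by blast
    then show ?thesis by (auto simp: weak_star_def PiE_UNIV_domain PiE_def Pi_def)
  qed
  moreover have "\<omega> \<in> ?X closure_of A" if \<omega>: "\<omega> \<in> pure_states M" for \<omega>
    unfolding in_closure_of
  proof (intro conjI allI impI)
    show "\<omega> \<in> topspace ?X" using calculation \<omega> by simp
    fix U assume U: "\<omega> \<in> U \<and> openin ?X U"
    then obtain T where T: "openin (product_topology (\<lambda>_. euclidean) M) T"
      "U = T \<inter> (states M \<inter> pure_states M)"
      unfolding weak_star_def subtopology_subtopology openin_subtopology by blast
    then obtain W where W: "finite {i \<in> M. W i \<noteq> (UNIV :: complex set)}" "\<And>i. i \<in> M \<Longrightarrow> open (W i)"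
      "\<omega> \<in> PiE M W" "PiE M W \<subseteq> T"
      using U unfolding openin_product_topology_alt by (metis IntD1 open_openin topspace_euclidean)
    define Y where "Y = {i \<in> M. W i \<noteq> UNIV}"
    have "\<exists>e>0. ball (\<omega> i) e \<subseteq> W i" if "i \<in> M" for i
      using W(2)[OF that] W(3) that by (auto simp: PiE_iff open_contains_ball)
    then obtain e where e: "\<And>i. i \<in> M \<Longrightarrow> 0 < e i" "\<And>i. i \<in> M \<Longrightarrow> ball (\<omega> i) (e i) \<subseteq> W i"
      by metis
    define m where "m = Min (insert 1 (e ` Y))"
    have finY: "finite Y" "Y \<subseteq> M" using W(1) by (auto simp: Y_def)
    then have "0 < m" using e(1) by (auto simp: m_def)
    obtain \<alpha> where \<alpha>: "\<alpha> \<in> A" "\<And>y. y \<in> Y \<Longrightarrow> cmod (\<alpha> y - \<omega> y) < m"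
      using approx[OF \<omega> finY \<open>0 < m\<close>] by blast
    have "\<alpha> i \<in> W i" if "i \<in> M" for i
    proof (cases "i \<in> Y")
      case True
      then have "m \<le> e i" using finY by (auto simp: m_def)
      then have "\<alpha> i \<in> ball (\<omega> i) (e i)"
        using \<alpha>(2)[OF True] by (simp add: dist_norm norm_minus_commute)
      then show ?thesis using e(2)[OF that] by blast
    qed (use that in \<open>auto simp: Y_def\<close>)
    moreover have \<alpha>P: "\<alpha> \<in> pure_states M" using \<alpha>(1) A by blast
    ultimately have "\<alpha> \<in> PiE M W"
      using ext by (simp add: PiE_iff)
    then have "\<alpha> \<in> U"
      using \<alpha>P pure_states_state W(4) T(2) by blast
    then show "\<exists>y. y \<in> A \<and> y \<in> U" using \<alpha>(1) by blast
  qed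
  ultimately show ?thesis
    unfolding weak_star_dense_in_pure_states_def using A closure_of_subset_topspace[of ?X A] by auto
qed

text \<open>
  Uniqueness of the maximizing real parts of functionals dominated by the numerical radius, at a point of
  positive numerical radius, is smoothness of the normalized point: a support functional at that
  point has there the real part one, and complex functionals with equal real parts coincide.
\<close>

lemma smooth_points_dense:
  fixes M :: "'b::unital_cstar_algebra set"
  assumes M: "unital_subspace M" and "closed M" "separable_space (top_of_set M)"
    and nonempty: "states UNIV \<noteq> ({} :: ('b \<Rightarrow> complex) set)"
    and z: "z \<in> M" and r: "0 < r"
  shows "\<exists>z'\<in>M. norm (z' - z) < r \<and> (0 < numerical_radius z' \<longrightarrow>
    (1 / numerical_radius z') *\<^sub>R z' \<in> smooth_points numerical_radius M)"
proof -
  let ?B = "{f \<in> linear_functionals M. \<forall>y\<in>M. cmod (f y) \<le> numerical_radius y}"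
  interpret real_parts: dominated_functionals M numerical_radius "(\<lambda>f x. Re (f x)) ` ?B"
  proof
    show "subspace M" by (rule real_subspace[OF M])
    show "\<bar>numerical_radius x - numerical_radius y\<bar> \<le> norm (x - y)" for x y :: 'b
      by (rule numerical_radius_lipschitz[OF nonempty])
    fix f assume "f \<in> (\<lambda>f x. Re (f x)) ` ?B"
    then obtain g where g: "g \<in> linear_functionals M" "\<And>y. y \<in> M \<Longrightarrow> cmod (g y) \<le> numerical_radius y"
      and f: "f = (\<lambda>x. Re (g x))" by blast
    show "f (x + s *\<^sub>R y) = f x + s * f y" if "x \<in> M" "y \<in> M" for x y s
      using that functional_add[OF g(1) that(1) subspace_scale[OF real_subspace[OF M] that(2)]]
        functional_scaleR[OF g(1) that(2)] by (simp add: f)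
    show "f x \<le> numerical_radius x" if "x \<in> M" for x
      unfolding f by (rule order_trans[OF complex_Re_le_cmod g(2)[OF that]])
    show "\<bar>f x\<bar> \<le> norm x" if "x \<in> M" for x
      unfolding f
      by (rule order_trans[OF abs_Re_le_cmod order_trans[OF g(2)[OF that] numerical_radius_le_norm[OF nonempty]]])
  qed
  obtain z' where z': "z' \<in> M" "norm (z' - z) < r"
    and all: "\<forall>f\<in>(\<lambda>f x. Re (f x)) ` ?B. \<forall>g\<in>(\<lambda>f x. Re (f x)) ` ?B.
      f z' = numerical_radius z' \<longrightarrow> g z' = numerical_radius z' \<longrightarrow> (\<forall>y\<in>M. f y = g y)"
    using real_parts.unique_support_functional_dense[OF assms(2,3) z r] by (elim bexE conjE)
  have unique: "Re (f y) = Re (g y)"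
    if "f \<in> ?B" "g \<in> ?B" "Re (f z') = numerical_radius z'" "Re (g z') = numerical_radius z'" "y \<in> M" for f g y
    by (rule all[rule_format, OF imageI[OF that(1)] imageI[OF that(2)] that(3-5)])
  have "(1 / numerical_radius z') *\<^sub>R z' \<in> smooth_points numerical_radius M" if pos: "0 < numerical_radius z'"
  proof -
    let ?x = "(1 / numerical_radius z') *\<^sub>R z'"
    have xM: "?x \<in> M" using subspace_scale[OF real_subspace[OF M] z'(1)] .
    have nx: "numerical_radius ?x = 1"
      using pos by (simp add: scaleR_scaleC numerical_radius_scaleC[OF nonempty] norm_divide)
    obtain \<psi> where \<psi>: "\<psi> \<in> states UNIV" "cmod (\<psi> ?x) = 1"
      using numerical_radius_attained[OF nonempty, of ?x] nx by auto
    have "cmod (restrict \<psi> M ?x) = 1" using \<psi>(2) xM by simp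
    note f = rotated_state_functional[OF M restrict_state[OF M \<psi>(1)] xM this]
    have "\<exists>!f. f \<in> linear_functionals M \<and> (\<forall>y\<in>M. cmod (f y) \<le> numerical_radius y) \<and> f ?x = 1"
    proof (rule ex_ex1I)
      show "\<exists>f. f \<in> linear_functionals M \<and> (\<forall>y\<in>M. cmod (f y) \<le> numerical_radius y) \<and> f ?x = 1"
        using f(1-3) by (intro exI conjI ballI)
      fix g h
      assume g: "g \<in> linear_functionals M \<and> (\<forall>y\<in>M. cmod (g y) \<le> numerical_radius y) \<and> g ?x = 1"
        and h: "h \<in> linear_functionals M \<and> (\<forall>y\<in>M. cmod (h y) \<le> numerical_radius y) \<and> h ?x = 1"
      have at: "Re (k z') = numerical_radius z'"
        if "k \<in> linear_functionals M" "k ?x = 1" for k :: "'b \<Rightarrow> complex"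
        using functional_scaleR[OF that(1) z'(1), of "1 / numerical_radius z'"] that(2) pos
        by (simp add: field_simps)
      have "Re (g y) = Re (h y)" if "y \<in> M" for y
        using unique[of g h y] g h at that by blast
      then show "g = h"
        using Re_functional_eqI[OF M] g h by blast
    qed
    with xM nx show ?thesis
      using smooth_points_iff[OF nonempty M] by blast
  qed
  with z' show ?thesis by blast
qed

text \<open>
  A large multiple \<open>c\<close> of the unit makes moduli at \<open>z = y + c 1\<close> nearly equal to real parts: the imaginary
  part contributes only \<open>O(1/c)\<close>. With \<open>c\<close> as chosen, half of the gap \<open>\<delta>\<close> between the real
  parts of \<open>\<omega>\<close> and of the slices survives for the moduli, and the other errors come from moving \<open>z\<close> by less
  than \<open>\<delta> / 8\<close>.
\<close>

theorem smooth_pure_states_avoid_slices: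
  fixes M :: "'b::unital_cstar_algebra set"
  assumes M: "unital_subspace M" and "closed M" "separable_space (top_of_set M)"
    and \<omega>: "\<omega> \<in> pure_states M" and V: "finite V" "V \<subseteq> M"
    and r: "\<And>u. u \<in> V \<Longrightarrow> Re (\<omega> u) < r u"
  shows "\<exists>\<alpha>\<in>smooth_pure_states M. \<forall>u\<in>V. Re (\<alpha> u) < r u"
proof -
  note \<omega>S = pure_states_state[OF \<omega>]
  note nonempty = states_nonempty[OF M \<omega>S]
  obtain y \<delta> where y: "y \<in> M" and \<delta>: "0 < \<delta>"
    and sep: "\<And>\<phi> u. \<phi> \<in> states UNIV \<Longrightarrow> u \<in> V \<Longrightarrow> r u \<le> Re (\<phi> u) \<Longrightarrow> Re (\<phi> y) \<le> Re (\<omega> y) - \<delta>"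
    using pure_state_slice_separation[OF M \<omega> V r] by blast
  define n where "n = norm y"
  define c where "c = n + \<delta> + n\<^sup>2 / \<delta>"
  define s where "s = c + Re (\<omega> y)"
  define z where "z = y + c *\<^sub>R 1"
  have zM: "z \<in> M"
    unfolding z_def using add_closed[OF M y] one_closed[OF M] subspace_scale[OF real_subspace[OF M]] by blast
  have n: "0 \<le> n" by (simp add: n_def)
  have ratio: "0 \<le> n\<^sup>2 / \<delta>" using \<delta> by simp
  have "\<bar>Re (\<omega> y)\<bar> \<le> n"
    unfolding n_def by (rule order_trans[OF abs_Re_le_cmod states_bound[OF \<omega>S y]])
  then have s: "\<delta> + n\<^sup>2 / \<delta> \<le> s" by (simp add: s_def c_def)
  have shifted: "\<phi> z = \<phi> y + complex_of_real c" if "\<phi> \<in> states N" "y \<in> N" "unital_subspace N" for \<phi> N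
    using that functional_add[OF states_functional[OF that(1)] that(2)
        subspace_scale[OF real_subspace[OF that(3)] one_closed[OF that(3)]], of c]
      functional_scaleR[OF states_functional[OF that(1)] one_closed[OF that(3)], of c]
    by (simp add: z_def states_one)
  have on_slice: "cmod (\<phi> z) \<le> s - \<delta> / 2" if \<phi>: "\<phi> \<in> states UNIV" and u: "u \<in> V" "r u \<le> Re (\<phi> u)" for \<phi> u
  proof (rule power2_le_imp_le)
    have b: "\<bar>Re (\<phi> y)\<bar> \<le> n" "\<bar>Im (\<phi> y)\<bar> \<le> n"
      unfolding n_def using states_bound[OF \<phi> UNIV_I, of y]
      by (auto intro: order_trans[OF abs_Re_le_cmod] order_trans[OF abs_Im_le_cmod])
    have "0 \<le> c + Re (\<phi> y)" using b(1) \<delta> ratio unfolding c_def by linarith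
    moreover have "c + Re (\<phi> y) \<le> s - \<delta>" using sep[OF \<phi> u] by (simp add: s_def)
    ultimately have "(c + Re (\<phi> y))\<^sup>2 \<le> (s - \<delta>)\<^sup>2" by (intro power_mono)
    moreover have "(Im (\<phi> y))\<^sup>2 \<le> n\<^sup>2" using b(2) n by (simp add: abs_le_square_iff[symmetric])
    moreover have "(s - \<delta>)\<^sup>2 + n\<^sup>2 \<le> (s - \<delta> / 2)\<^sup>2"
    proof -
      have "\<delta> * (\<delta> + n\<^sup>2 / \<delta>) \<le> \<delta> * s" using s \<delta> by (intro mult_left_mono) auto
      moreover have "\<delta> * (\<delta> + n\<^sup>2 / \<delta>) = \<delta> * \<delta> + n\<^sup>2"
        using \<delta> by (simp add: distrib_left)
      moreover have "(s - \<delta> / 2)\<^sup>2 - (s - \<delta>)\<^sup>2 = \<delta> * s - 3 / 4 * (\<delta> * \<delta>)"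
        by (simp add: power2_eq_square algebra_simps)
      moreover have "0 \<le> \<delta> * \<delta>" by simp
      ultimately show ?thesis by linarith
    qed
    ultimately show "(cmod (\<phi> z))\<^sup>2 \<le> (s - \<delta> / 2)\<^sup>2"
      using shifted[OF \<phi> UNIV_I unital_subspace_UNIV] by (simp add: cmod_power2 add.commute)
    show "0 \<le> s - \<delta> / 2" using s \<delta> ratio by linarith
  qed
  obtain z' where z': "z' \<in> M" "norm (z' - z) < \<delta> / 8"
    and smooth: "0 < numerical_radius z' \<Longrightarrow> (1 / numerical_radius z') *\<^sub>R z' \<in> smooth_points numerical_radius M"
    using smooth_points_dense[OF assms(1-3) nonempty zM, of "\<delta> / 8"] \<delta> by auto
  have move: "\<bar>cmod (\<phi> z') - cmod (\<phi> z)\<bar> \<le> \<delta> / 8" if "\<phi> \<in> states N" "M \<subseteq> N" "unital_subspace N" for \<phi> N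
  proof -
    have zz: "z \<in> N" "z' \<in> N" "z' - z \<in> N"
      using that(2) zM z'(1) subspace_diff[OF real_subspace[OF that(3)]] by auto
    have "\<phi> z' = \<phi> z + \<phi> (z' - z)"
      using functional_add[OF states_functional[OF that(1)] zz(1,3)] by simp
    then have "\<bar>cmod (\<phi> z') - cmod (\<phi> z)\<bar> \<le> cmod (\<phi> (z' - z))"
      using norm_triangle_ineq3[of "\<phi> z'" "\<phi> z"] by simp
    also have "\<dots> \<le> norm (z' - z)" by (rule states_bound[OF that(1) zz(3)])
    finally show ?thesis using z'(2) by linarith
  qed
  have "s \<le> cmod (\<omega> z)"
    using complex_Re_le_cmod[of "\<omega> z"] shifted[OF \<omega>S y M] by (simp add: s_def)
  then have nr: "s - \<delta> / 8 \<le> numerical_radius z'"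
    using move[OF \<omega>S subset_refl M] substate_le_numerical_radius[OF M \<omega>S z'(1)] by linarith
  then have pos: "0 < numerical_radius z'" using s \<delta> ratio by linarith
  let ?x = "(1 / numerical_radius z') *\<^sub>R z'"
  note x = smooth[OF pos]
  have xM: "?x \<in> M" using subspace_scale[OF real_subspace[OF M] z'(1)] .
  have val_x: "cmod (\<phi> ?x) = cmod (\<phi> z') / numerical_radius z'" if "\<phi> \<in> states UNIV" for \<phi>
    using functional_scaleR[OF states_functional[OF that] UNIV_I] pos by (simp add: norm_mult norm_divide)
  obtain \<psi> where \<psi>: "\<psi> \<in> states UNIV" "cmod (\<psi> z') = numerical_radius z'"
    using numerical_radius_attained[OF nonempty] by blast
  have "cmod (restrict \<psi> M ?x) = 1"
    using val_x[OF \<psi>(1)] \<psi>(2) pos xM by simp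
  then have "restrict \<psi> M \<in> pure_states M"
    by (rule smooth_state_pure[OF M x restrict_state[OF M \<psi>(1)]])
  then obtain \<alpha> where \<alpha>: "\<alpha> \<in> pure_states UNIV" "restrict \<alpha> M = restrict \<psi> M"
    using pure_state_extension[OF M] by blast
  note \<alpha>S = pure_states_state[OF \<alpha>(1)]
  have eq: "\<alpha> v = \<psi> v" if "v \<in> M" for v
    using fun_cong[OF \<alpha>(2), of v] that by simp
  have "\<alpha> \<in> smooth_pure_states M"
    using \<alpha>(1) x val_x[OF \<psi>(1)] \<psi>(2) pos eq[OF xM] by (auto simp: smooth_pure_states_def intro!: bexI[of _ ?x])
  moreover have "Re (\<alpha> u) < r u" if "u \<in> V" for u
  proof (rule ccontr)
    assume "\<not> Re (\<alpha> u) < r u"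
    then have "cmod (\<alpha> z) \<le> s - \<delta> / 2" using on_slice[OF \<alpha>S that] by simp
    then have "cmod (\<alpha> z') < s - \<delta> / 8"
      using move[OF \<alpha>S subset_UNIV unital_subspace_UNIV] \<delta> by linarith
    then show False using nr \<psi>(2) eq[OF z'(1)] by simp
  qed
  ultimately show ?thesis by blast
qed

text \<open>
  A basic weak-* neighbourhood contains the complement of the slices in the directions \<open>c y\<close> with \<open>c\<close> a
  fourth root of unity, which bound the real and the imaginary part of \<open>\<alpha> y - \<omega> y\<close> from both sides.
\<close>

theorem smooth_pure_states_dense:
  fixes M :: "'b::unital_cstar_algebra set"
  assumes M: "unital_subspace M" and "closed M" "separable_space (top_of_set M)"
    and \<omega>: "\<omega> \<in> pure_states M" and Y: "finite Y" "Y \<subseteq> M" and e: "0 < e"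
  shows "\<exists>\<alpha>\<in>smooth_pure_states M. \<forall>y\<in>Y. cmod (\<alpha> y - \<omega> y) < e"
proof -
  define V where "V = (\<Union>c\<in>{1, - 1, \<i>, - \<i>}. (\<lambda>y. c *\<^sub>C y) ` Y)"
  have V: "finite V" "V \<subseteq> M"
    unfolding V_def using Y by (auto simp del: complex_vector.scale_minus_left intro!: scaleC_closed[OF M])
  obtain \<alpha> where \<alpha>: "\<alpha> \<in> smooth_pure_states M" "\<And>u. u \<in> V \<Longrightarrow> Re (\<alpha> u) < Re (\<omega> u) + e / 2"
    using smooth_pure_states_avoid_slices[OF assms(1-4) V, of "\<lambda>u. Re (\<omega> u) + e / 2"] e by auto
  have \<alpha>lin: "\<alpha> \<in> linear_functionals UNIV"
    using \<alpha>(1) by (auto simp: smooth_pure_states_def intro: states_functional pure_states_state)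
  note \<omega>lin = states_functional[OF pure_states_state[OF \<omega>]]
  have "cmod (\<alpha> y - \<omega> y) < e" if y: "y \<in> Y" for y
  proof -
    have dir: "Re (c * \<alpha> y) < Re (c * \<omega> y) + e / 2" if "c *\<^sub>C y \<in> V" for c
      using \<alpha>(2)[OF that] functional_scaleC[OF \<alpha>lin UNIV_I, of c y] functional_scaleC[OF \<omega>lin, of y c] y Y(2)
      by auto
    have "1 *\<^sub>C y \<in> V" "(-1) *\<^sub>C y \<in> V" "\<i> *\<^sub>C y \<in> V" "(- \<i>) *\<^sub>C y \<in> V"
      unfolding V_def using y by blast+
    from this[THEN dir] have "Re (\<alpha> y) < Re (\<omega> y) + e / 2" "- Re (\<alpha> y) < - Re (\<omega> y) + e / 2"
      "- Im (\<alpha> y) < - Im (\<omega> y) + e / 2" "Im (\<alpha> y) < Im (\<omega> y) + e / 2"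
      by simp_all
    then have "\<bar>Re (\<alpha> y - \<omega> y)\<bar> < e / 2" "\<bar>Im (\<alpha> y - \<omega> y)\<bar> < e / 2"
      unfolding minus_complex.sel by linarith+
    then show ?thesis
      using cmod_le[of "\<alpha> y - \<omega> y"] by linarith
  qed
  with \<alpha>(1) show ?thesis by blast
qed

theorem theorem5p3:
  fixes M :: "'b::unital_cstar_algebra set"
  assumes "unital_subspace M"
    and "separable_space (top_of_set M)"
    and "closed M"
  shows "weak_star_dense_in_pure_states M ((\<lambda>\<omega>. restrict \<omega> M) ` smooth_pure_states M)
       \<and> weak_star_dense_in_pure_states M ((\<lambda>\<omega>. restrict \<omega> M) ` peak_pure_states M)"
proof -
  note subset = smooth_pure_states_subset_peak[OF assms(1)]
  have pure: "(\<lambda>\<omega>. restrict \<omega> M) ` peak_pure_states M \<subseteq> pure_states M"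
    using peak_pure_states_restrict[OF assms(1)] by blast
  have approx: "\<exists>\<alpha>\<in>(\<lambda>\<omega>. restrict \<omega> M) ` P. \<forall>y\<in>Y. cmod (\<alpha> y - \<omega> y) < e"
    if P: "smooth_pure_states M \<subseteq> P" and \<omega>: "\<omega> \<in> pure_states M" and Y: "finite Y" "Y \<subseteq> M" and e: "0 < e"
    for P \<omega> Y e
  proof -
    obtain \<alpha> where "\<alpha> \<in> smooth_pure_states M" "\<forall>y\<in>Y. cmod (\<alpha> y - \<omega> y) < e"
      using smooth_pure_states_dense[OF assms(1,3,2) \<omega> Y e] by blast
    then show ?thesis
      using P Y(2) by (intro bexI[of _ "restrict \<alpha> M"]) auto
  qed
  show ?thesis
  proof
    show "weak_star_dense_in_pure_states M ((\<lambda>\<omega>. restrict \<omega> M) ` smooth_pure_states M)"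
      using pure subset by (intro weak_star_denseI approx[OF subset_refl]) auto
    show "weak_star_dense_in_pure_states M ((\<lambda>\<omega>. restrict \<omega> M) ` peak_pure_states M)"
      using pure by (intro weak_star_denseI approx[OF subset]) auto
  qed
qed

end
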